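(* For all $X\subseteq\mathbf C$: (1) $\dim_{\#\mathrm P}(X)\le\mathcal H_{\mathrm{UP}}(X)\le\mathcal H_{\mathrm P}(X)$; (2) $\dim_{\mathrm{SpanP}}(X)\le\mathcal H_{\mathrm{NP}}(X)$; (3) $\dim_{\mathrm{GapP}}(X)\le\mathcal H_{\mathrm{SPP}}(X)$; (4) $\mathrm{Dim}_{\#\mathrm P}(X)\le\mathcal H^{\mathrm{str}}_{\mathrm{UP}}(X)\le\mathcal H^{\mathrm{str}}_{\mathrm P}(X)$; (5) $\mathrm{Dim}_{\mathrm{SpanP}}(X)\le\mathcal H^{\mathrm{str}}_{\mathrm{NP}}(X)$; (6) $\mathrm{Dim}_{\mathrm{GapP}}(X)\le\mathcal H^{\mathrm{str}}_{\mathrm{SPP}}(X)$.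
   Context: $\mathbf C=\{0,1\}^\infty$ is Cantor space; $S\upharpoonright n$ is the length-$n$ prefix of $S$. For $A\subseteq\{0,1\}^*$, $A_{=n}=A\cap\{0,1\}^n$, the entropy rate is $H_A=\limsup_n\frac{\log|A_{=n}|}{n}$, $A^{\mathrm{i.o.}}=\{S:S\upharpoonright n\in A\text{ for infinitely many }n\}$ and $A^{\mathrm{a.e.}}=\{S:S\upharpoonright n\in A\text{ for all but finitely many }n\}$. For a class $\mathcal C$ of languages, $\mathcal H_{\mathcal C}(X)=\inf\{H_A:A\in\mathcal C, X\subseteq A^{\mathrm{i.o.}}\}$ and $\mathcal H^{\mathrm{str}}_{\mathcal C}(X)=\inf\{H_A:A\in\mathcal C,X\subseteq A^{\mathrm{a.e.}}\}$. SPP is the class of languages whose characteristic function is a GapP function. A martingale is $d:\{0,1\}^*\to[0,\infty)$ with $d(w)=\frac{d(w0)+d(w1)}{2}$; for $s>0$ it $s$-succeeds on $S$ if $d(S\upharpoonright n)\ge2^{(1-s)n}$ for infinitely many $n$, and $s$-strongly succeeds if for all but finitely many $n$. #P functions count accepting paths of a polynomial-time nondeterministic Turing machine; SpanP functions count the distinct outputs of a polynomial-time nondeterministic machine that outputs a string or nothing on each path; GapP functions are accepting minus rejecting path counts. For $\Delta\in\{\#\mathrm P,\mathrm{SpanP},\mathrm{GapP}\}$, a $\Delta$-martingale is a martingale $d$ for which there are $f\in\Delta$ and a polynomial-time computable $g$ with power-of-2 values such that $|d(w)-f(w,r)/g(w,r)|\le2^{-r}$ for all $w$ and $r\in\mathbb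 N$ ($r$ in unary); $\dim_\Delta(X)$ (resp. $\mathrm{Dim}_\Delta(X)$) is the infimum of $s$ such that some $\Delta$-martingale $s$-succeeds (resp. $s$-strongly succeeds) on every element of $X$. *)

theory Defs
  imports
    Complex_Main
    "HOL-Library.Extended_Real"
    "HOL-Library.Infinite_Set"
    "HOL-Computational_Algebra.Polynomial"
begin

section \<open>Multi-tape nondeterministic Turing machines\<close>

datatype symbol = Blank | Bit bool | Mark nat

datatype move = MoveL | Stay | MoveR

text \<open>
  A transition \<open>(q, \<gamma>, q', \<alpha>)\<close> may be taken in state \<open>q\<close> when the heads read \<open>\<gamma>\<close> (one symbol
  per tape); the machine goes to state \<open>q'\<close> and each head writes and moves as given by \<open>\<alpha>\<close>.
\<close>
type_synonym transition = "nat \<times> symbol list \<times> nat \<times> (symbol \<times> move) list"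

record ntm =
  ntapes :: nat
  start :: nat
  accepting :: "nat set"
  transitions :: "transition set"

text \<open>
  States and auxiliary symbols are drawn from infinite supplies; since there are only
  finitely many transitions, each machine uses only finitely many of them.
\<close>
definition ntm :: "ntm \<Rightarrow> bool" where
  "ntm M \<longleftrightarrow> 0 < ntapes M \<and> finite (accepting M) \<and> finite (transitions M) \<and>
     (\<forall>(q, \<gamma>, q', \<alpha>) \<in> transitions M. length \<gamma> = ntapes M \<and> length \<alpha> = ntapes M)"

definition deterministic :: "ntm \<Rightarrow> bool" where
  "deterministic M \<longleftrightarrow>
     (\<forall>q \<gamma> q1 \<alpha>1 q2 \<alpha>2. (q, \<gamma>, q1, \<alpha>1) \<in> transitions M \<longrightarrow> (q, \<gamma>, q2, \<alpha>2) \<in> transitions M \<longrightarrow>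
        q1 = q2 \<and> \<alpha>1 = \<alpha>2)"

text \<open>Tapes are two-way infinite; a tape is its contents together with the head position.\<close>
type_synonym tape = "(int \<Rightarrow> symbol) \<times> int"

type_synonym config = "nat \<times> tape list"

definition read :: "tape \<Rightarrow> symbol" where
  "read t = fst t (snd t)"

fun displacement :: "move \<Rightarrow> int" where
  "displacement MoveL = - 1"
| "displacement Stay = 0"
| "displacement MoveR = 1"

fun act :: "symbol \<times> move \<Rightarrow> tape \<Rightarrow> tape" where
  "act (a, m) (c, p) = (c(p := a), p + displacement m)"

fun enabled :: "config \<Rightarrow> transition \<Rightarrow> bool" where
  "enabled (p, ts) (q, \<gamma>, q', \<alpha>) \<longleftrightarrow> q = p \<and> \<gamma> = map read ts"

fun fire :: "transition \<Rightarrow> config \<Rightarrow> config" where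
  "fire (q, \<gamma>, q', \<alpha>) (p, ts) = (q', map2 act \<alpha> ts)"

definition halted :: "ntm \<Rightarrow> config \<Rightarrow> bool" where
  "halted M c \<longleftrightarrow> (\<forall>\<tau> \<in> transitions M. \<not> enabled c \<tau>)"

definition blank_tape :: tape where
  "blank_tape = (\<lambda>_. Blank, 0)"

definition input_tape :: "bool list \<Rightarrow> tape" where
  "input_tape x = (\<lambda>i. if 0 \<le> i \<and> i < int (length x) then Bit (x ! nat i) else Blank, 0)"

definition initial :: "ntm \<Rightarrow> bool list \<Rightarrow> config" where
  "initial M x = (start M, input_tape x # replicate (ntapes M - 1) blank_tape)"

text \<open>A computation is the list of transitions taken, so distinct choices are distinct paths.\<close>
fun computation :: "ntm \<Rightarrow> config \<Rightarrow> transition list \<Rightarrow> config \<Rightarrow> bool" where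
  "computation M c [] c' \<longleftrightarrow> c' = c"
| "computation M c (\<tau> # \<tau>s) c' \<longleftrightarrow>
     \<tau> \<in> transitions M \<and> enabled c \<tau> \<and> computation M (fire \<tau> c) \<tau>s c'"

definition halting_path :: "ntm \<Rightarrow> bool list \<Rightarrow> transition list \<Rightarrow> config \<Rightarrow> bool" where
  "halting_path M x \<tau>s c \<longleftrightarrow> computation M (initial M x) \<tau>s c \<and> halted M c"

definition accepting_paths :: "ntm \<Rightarrow> bool list \<Rightarrow> transition list set" where
  "accepting_paths M x = {\<tau>s. \<exists>c. halting_path M x \<tau>s c \<and> fst c \<in> accepting M}"

definition rejecting_paths :: "ntm \<Rightarrow> bool list \<Rightarrow> transition list set" where
  "rejecting_paths M x = {\<tau>s. \<exists>c. halting_path M x \<tau>s c \<and> fst c \<notin> accepting M}"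

text \<open>
  The output is the maximal block of bits on the last tape that starts at cell 0, where
  the head of that tape was placed initially.
\<close>
definition has_output :: "config \<Rightarrow> bool list \<Rightarrow> bool" where
  "has_output c y \<longleftrightarrow>
     (\<forall>i < length y. fst (last (snd c)) (int i) = Bit (y ! i)) \<and>
     (\<forall>b. fst (last (snd c)) (int (length y)) \<noteq> Bit b)"

text \<open>Every path, not just some path, has to halt within the time bound.\<close>
definition poly_time :: "ntm \<Rightarrow> bool" where
  "poly_time M \<longleftrightarrow>
     (\<exists>p :: nat poly. \<forall>x \<tau>s c. computation M (initial M x) \<tau>s c \<longrightarrow> length \<tau>s \<le> poly p (length x))"


section \<open>Complexity classes\<close>

definition class_P :: "bool list set set" where
  "class_P = {A. \<exists>M. ntm M \<and> deterministic M \<and> poly_time M \<and> A = {x. accepting_paths M x \<noteq> {}}}"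

definition class_NP :: "bool list set set" where
  "class_NP = {A. \<exists>M. ntm M \<and> poly_time M \<and> A = {x. accepting_paths M x \<noteq> {}}}"

definition class_UP :: "bool list set set" where
  "class_UP = {A. \<exists>M. ntm M \<and> poly_time M \<and> (\<forall>x. card (accepting_paths M x) \<le> 1) \<and>
                      A = {x. accepting_paths M x \<noteq> {}}}"

text \<open>The three counting classes are all taken to consist of integer-valued functions.\<close>

definition SharpP :: "(bool list \<Rightarrow> int) set" where
  "SharpP = {f. \<exists>M. ntm M \<and> poly_time M \<and> (\<forall>x. f x = int (card (accepting_paths M x)))}"

text \<open>A path that does not accept outputs nothing.\<close>
definition SpanP :: "(bool list \<Rightarrow> int) set" where
  "SpanP = {f. \<exists>M. ntm M \<and> poly_time M \<and>
     (\<forall>x. f x = int (card {y. \<exists>\<tau>s c. halting_path M x \<tau>s c \<and> fst c \<in> accepting M \<and> has_output c y}))}"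

definition GapP :: "(bool list \<Rightarrow> int) set" where
  "GapP = {f. \<exists>M. ntm M \<and> poly_time M \<and>
     (\<forall>x. f x = int (card (accepting_paths M x)) - int (card (rejecting_paths M x)))}"

definition class_SPP :: "bool list set set" where
  "class_SPP = {A. (\<lambda>x. of_bool (x \<in> A)) \<in> GapP}"

text \<open>Binary numerals, most significant bit first.\<close>
definition binary_value :: "bool list \<Rightarrow> nat" where
  "binary_value y = horner_sum of_bool 2 (rev y)"

definition poly_time_computable :: "(bool list \<Rightarrow> nat) \<Rightarrow> bool" where
  "poly_time_computable g \<longleftrightarrow> (\<exists>M. ntm M \<and> deterministic M \<and> poly_time M \<and>
     (\<forall>x. \<exists>\<tau>s c y. halting_path M x \<tau>s c \<and> has_output c y \<and> g x = binary_value y))"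


section \<open>Martingales and dimension in Cantor space\<close>

definition prefix_of :: "(nat \<Rightarrow> bool) \<Rightarrow> nat \<Rightarrow> bool list" where
  "prefix_of S n = map S [0..<n]"

definition martingale :: "(bool list \<Rightarrow> real) \<Rightarrow> bool" where
  "martingale d \<longleftrightarrow> (\<forall>w. 0 \<le> d w) \<and> (\<forall>w. d w = (d (w @ [False]) + d (w @ [True])) / 2)"

definition succeeds :: "real \<Rightarrow> (bool list \<Rightarrow> real) \<Rightarrow> (nat \<Rightarrow> bool) \<Rightarrow> bool" where
  "succeeds s d S \<longleftrightarrow> (\<exists>\<^sub>\<infinity>n. d (prefix_of S n) \<ge> 2 powr ((1 - s) * real n))"

definition strongly_succeeds :: "real \<Rightarrow> (bool list \<Rightarrow> real) \<Rightarrow> (nat \<Rightarrow> bool) \<Rightarrow> bool" where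
  "strongly_succeeds s d S \<longleftrightarrow> (\<forall>\<^sub>\<infinity>n. d (prefix_of S n) \<ge> 2 powr ((1 - s) * real n))"

text \<open>The pair of \<open>w\<close> and \<open>r\<close> in unary is given to a machine as the string \<open>1\<^sup>r0w\<close>.\<close>
definition encode_pair :: "bool list \<Rightarrow> nat \<Rightarrow> bool list" where
  "encode_pair w r = replicate r True @ False # w"

definition class_martingale :: "(bool list \<Rightarrow> int) set \<Rightarrow> (bool list \<Rightarrow> real) \<Rightarrow> bool" where
  "class_martingale \<Delta> d \<longleftrightarrow> martingale d \<and>
     (\<exists>f \<in> \<Delta>. \<exists>g. poly_time_computable g \<and> (\<forall>w r. \<exists>k. g (encode_pair w r) = 2 ^ k) \<and>
        (\<forall>w r. \<bar>d w - real_of_int (f (encode_pair w r)) / real (g (encode_pair w r))\<bar>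
                 \<le> 2 powr (- real r)))"

definition dimension :: "(bool list \<Rightarrow> int) set \<Rightarrow> (nat \<Rightarrow> bool) set \<Rightarrow> ereal" where
  "dimension \<Delta> X =
     Inf {ereal s | s. 0 < s \<and> (\<exists>d. class_martingale \<Delta> d \<and> (\<forall>S \<in> X. succeeds s d S))}"

definition strong_dimension :: "(bool list \<Rightarrow> int) set \<Rightarrow> (nat \<Rightarrow> bool) set \<Rightarrow> ereal" where
  "strong_dimension \<Delta> X =
     Inf {ereal s | s. 0 < s \<and> (\<exists>d. class_martingale \<Delta> d \<and> (\<forall>S \<in> X. strongly_succeeds s d S))}"


section \<open>Entropy rates\<close>

definition slice :: "bool list set \<Rightarrow> nat \<Rightarrow> bool list set" where
  "slice A n = {x \<in> A. length x = n}"

text \<open>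
  Here \<open>log 2 0 = 0\<close>, so a finite language has entropy rate 0 rather than \<open>-\<infinity>\<close>. For infinite
  languages the value given to the logarithm of 0 is irrelevant, because the limit superior
  is nonnegative anyway; only the empty set is covered by a finite language.
\<close>
definition entropy_rate :: "bool list set \<Rightarrow> ereal" where
  "entropy_rate A = limsup (\<lambda>n. ereal (log 2 (real (card (slice A n))) / real n))"

definition io_set :: "bool list set \<Rightarrow> (nat \<Rightarrow> bool) set" where
  "io_set A = {S. \<exists>\<^sub>\<infinity>n. prefix_of S n \<in> A}"

definition ae_set :: "bool list set \<Rightarrow> (nat \<Rightarrow> bool) set" where
  "ae_set A = {S. \<forall>\<^sub>\<infinity>n. prefix_of S n \<in> A}"

definition entropy :: "bool list set set \<Rightarrow> (nat \<Rightarrow> bool) set \<Rightarrow> ereal" where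
  "entropy \<C> X = Inf {entropy_rate A | A. A \<in> \<C> \<and> X \<subseteq> io_set A}"

definition strong_entropy :: "bool list set set \<Rightarrow> (nat \<Rightarrow> bool) set \<Rightarrow> ereal" where
  "strong_entropy \<C> X = Inf {entropy_rate A | A. A \<in> \<C> \<and> X \<subseteq> ae_set A}"

end

theory Submission
  imports Defs "HOL-Library.Countable"
begin

text \<open>
  Let \<open>H\<^sub>A < a/b < s\<close> with \<open>a \<le> b\<close>. For \<open>n \<ge> |w|\<close> put \<open>N\<^sub>n(w) = 2\<^sup>|\<^sup>w\<^sup>|\<close> times the number of extensions of
  \<open>w\<close> in \<open>A\<^sub>=\<^sub>n\<close>, and let \<open>N\<^sub>n\<close> stay constant beyond length \<open>n\<close>. The martingale
  \<open>d(w) = \<Sum>\<^sub>n N\<^sub>n(w) / 2 ^ \<lfloor>a n / b\<rfloor>\<close> converges geometrically and satisfies \<open>d(w) \<ge> 2 powr ((1 - s) |w|)\<close>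
  for \<open>w \<in> A\<close>. Truncating the sum at a suitable \<open>L\<close> linear in \<open>|w| + r\<close> gives an error of at
  most \<open>2\<^sup>-\<^sup>r\<close>, and \<open>2 ^ \<lfloor>a L / b\<rfloor>\<close> times the truncated sum counts the guesses of a machine that chooses
  \<open>n \<le> L\<close>, a string \<open>x\<close> of length \<open>n\<close> compatible with \<open>w\<close> and some dummy bits, and then runs the machine
  for \<open>A\<close> on \<open>x\<close>. For \<open>s > 1\<close> the constant martingale 1 suffices.
\<close>

section \<open>Counting along computation trees\<close>

text \<open>The three counting classes treat multiplicities differently: #P counts paths, SpanP
  ignores repetitions of an output, GapP also charges for rejecting paths. One machine serves all of
  them because every guess is made and recorded before the machine for \<open>A\<close> starts, and
  no path halts earlier. Each leaf of the guessing tree then contributes the indicator of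
  \<open>A\<close>, be it as a path count, a gap or the presence of one output, and the leaves
  simply add up. A common denominator forces the weight \<open>2 ^ (c L - c n)\<close> with
  \<open>c n\<close> the floor of \<open>a n / b\<close>, and a finite control has to produce it.
  This is why the rate is rational: whether \<open>c\<close> increases at a tick depends only on the
  tick number modulo \<open>b\<close>, and \<open>a \<le> b\<close> makes it increase by at most
  one, so one dummy bit per increase after the stop is exactly right. Likewise a dummy bit for each
  copied bit of \<open>w\<close> yields the powers of 2 that make the sum a martingale. The tail
  must beat both \<open>2 ^ length w\<close> and \<open>2 ^ r\<close>, so the ticks have to be a
  large multiple of the input length; hence the slow sweep. Restricted to padding without guesses,
  the same machine prints the denominator.\<close>

definition moves :: "ntm \<Rightarrow> config \<Rightarrow> transition set" where
  "moves K c = {\<tau> \<in> transitions K. enabled c \<tau>}"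

text \<open>The predicate on the final state lets one notion cover accepting paths, rejecting paths
  and, with the constant false predicate, none.\<close>

definition paths :: "ntm \<Rightarrow> (nat \<Rightarrow> bool) \<Rightarrow> config \<Rightarrow> transition list set" where
  "paths K P c = {\<tau>s. \<exists>c'. computation K c \<tau>s c' \<and> halted K c' \<and> P (fst c')}"

definition outputs :: "ntm \<Rightarrow> config \<Rightarrow> bool list set" where
  "outputs K c = {y. \<exists>\<tau>s c'. computation K c \<tau>s c' \<and> halted K c' \<and> fst c' \<in> accepting K \<and> has_output c' y}"

definition writes :: "transition \<Rightarrow> bool \<Rightarrow> bool" where
  "writes \<tau> b \<longleftrightarrow> last (snd (snd (snd \<tau>))) = (Bit b, MoveR)"

text \<open>The head rests on the first blank cell after \<open>z\<close>. Besides the output tape,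
  the first tape of \<open>M\<close> has this form while its input is being generated.\<close>

definition written :: "bool list \<Rightarrow> tape" where
  "written z = (fst (input_tape z), int (length z))"

text \<open>
  Every branching is binary and is recorded by the bit that it writes on the output tape. This
  makes distinct branches have distinct outputs, so that the number of accepting paths, the gap
  and the number of outputs are all additive along the tree.
\<close>
inductive unfolds :: "ntm \<Rightarrow> (config \<Rightarrow> int \<Rightarrow> bool) \<Rightarrow> config \<Rightarrow> nat \<Rightarrow> int \<Rightarrow> bool"
  for K leaf where
  unfolds_leaf: "leaf c N \<Longrightarrow> unfolds K leaf c t N"
| unfolds_step: "moves K c = {\<tau>} \<Longrightarrow> unfolds K leaf (fire \<tau> c) t N \<Longrightarrow> unfolds K leaf c (Suc t) N"
| unfolds_branch: "moves K c = {\<tau>1, \<tau>2} \<Longrightarrow> writes \<tau>1 False \<Longrightarrow> writes \<tau>2 True \<Longrightarrow>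
    unfolds K leaf (fire \<tau>1 c) t N1 \<Longrightarrow> unfolds K leaf (fire \<tau>2 c) t N2 \<Longrightarrow>
    unfolds K leaf c (Suc t) (N1 + N2)"

lemma unfolds_mono: "unfolds K leaf c t N \<Longrightarrow> t \<le> t' \<Longrightarrow> unfolds K leaf c t' N"
proof (induction arbitrary: t' rule: unfolds.induct)
  case (unfolds_leaf c N t)
  then show ?case by (intro unfolds.unfolds_leaf)
next
  case (unfolds_step c \<tau> t N)
  then obtain t'' where "t' = Suc t''" "t \<le> t''" by (cases t') auto
  then show ?case using unfolds_step by (auto intro: unfolds.unfolds_step)
next
  case (unfolds_branch c \<tau>1 \<tau>2 t N1 N2)
  then obtain t'' where "t' = Suc t''" "t \<le> t''" by (cases t') auto
  then show ?case using unfolds_branch by (auto intro: unfolds.unfolds_branch)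
qed

lemma computation_cases_moves:
  "computation K c \<tau>s c' \<longleftrightarrow>
    (\<tau>s = [] \<and> c' = c) \<or> (\<exists>\<tau>\<in>moves K c. \<exists>\<sigma>s. \<tau>s = \<tau> # \<sigma>s \<and> computation K (fire \<tau> c) \<sigma>s c')"
  by (cases \<tau>s) (auto simp: moves_def)

lemma halted_iff_moves: "halted K c \<longleftrightarrow> moves K c = {}"
  by (auto simp: halted_def moves_def)

lemma paths_unfold:
  assumes "moves K c \<noteq> {}"
  shows "paths K P c = (\<Union>\<tau>\<in>moves K c. (#) \<tau> ` paths K P (fire \<tau> c))" (is "?L = ?R")
proof (intro set_eqI)
  fix \<tau>s
  show "\<tau>s \<in> ?L \<longleftrightarrow> \<tau>s \<in> ?R"
    using assms unfolding paths_def mem_Collect_eq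
    by (subst computation_cases_moves) (auto simp: halted_iff_moves)
qed

lemma outputs_unfold:
  assumes "moves K c \<noteq> {}"
  shows "outputs K c = (\<Union>\<tau>\<in>moves K c. outputs K (fire \<tau> c))" (is "?L = ?R")
proof (intro set_eqI)
  fix y
  show "y \<in> ?L \<longleftrightarrow> y \<in> ?R"
    using assms unfolding outputs_def mem_Collect_eq
    by (subst computation_cases_moves) (auto simp: halted_iff_moves, blast+)
qed

lemma writes_unique: "writes \<tau> a \<Longrightarrow> writes \<tau> b \<Longrightarrow> a = b"
  by (simp add: writes_def)

lemma card_paths_step:
  "moves K c = {\<tau>} \<Longrightarrow> finite (paths K P (fire \<tau> c)) \<Longrightarrow>
    finite (paths K P c) \<and> card (paths K P c) = card (paths K P (fire \<tau> c))"
  by (simp add: paths_unfold card_image)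

lemma card_paths_branch:
  assumes "moves K c = {\<tau>1, \<tau>2}" "writes \<tau>1 False" "writes \<tau>2 True"
    and "finite (paths K P (fire \<tau>1 c))" "finite (paths K P (fire \<tau>2 c))"
  shows "finite (paths K P c) \<and>
    card (paths K P c) = card (paths K P (fire \<tau>1 c)) + card (paths K P (fire \<tau>2 c))"
proof -
  have "\<tau>1 \<noteq> \<tau>2" using assms writes_unique by blast
  then show ?thesis using assms
    by (auto simp: paths_unfold card_image intro!: card_Un_disjoint[THEN trans])
qed

text \<open>Putting a transition in front of a path is injective, and the transitions at a branching
  differ, so the counts add up. For GapP, \<open>Q\<close> means rejecting; for #P it is constantly
  false.\<close>

lemma unfolds_gap:
  assumes "unfolds K leaf c t N"
    and "\<And>c N. leaf c N \<Longrightarrow> finite (paths K P c) \<and> finite (paths K Q c) \<and>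
      int (card (paths K P c)) - int (card (paths K Q c)) = N"
  shows "finite (paths K P c) \<and> finite (paths K Q c) \<and>
      int (card (paths K P c)) - int (card (paths K Q c)) = N"
  using assms(1)
proof (induction rule: unfolds.induct)
  case (unfolds_leaf c N t)
  then show ?case using assms(2) by blast
next
  case (unfolds_step c \<tau> t N)
  then show ?case using card_paths_step[OF unfolds_step.hyps(1), of P]
    card_paths_step[OF unfolds_step.hyps(1), of Q] by auto
next
  case (unfolds_branch c \<tau>1 \<tau>2 t N1 N2)
  then show ?case using card_paths_branch[OF unfolds_branch.hyps(1-3), of P]
    card_paths_branch[OF unfolds_branch.hyps(1-3), of Q] by auto
qed

lemma unfolds_time:
  assumes "unfolds K leaf c t N"
    and "\<And>c N \<tau>s c'. leaf c N \<Longrightarrow> computation K c \<tau>s c' \<Longrightarrow> length \<tau>s \<le> T"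
    and "computation K c \<tau>s c'"
  shows "length \<tau>s \<le> T + t"
  using assms(1,3)
proof (induction arbitrary: \<tau>s rule: unfolds.induct)
  case (unfolds_leaf c N t)
  then show ?case using assms(2) trans_le_add1 by blast
next
  case (unfolds_step c \<tau> t N)
  then show ?case using computation_cases_moves[of K c \<tau>s c'] by auto
next
  case (unfolds_branch c \<tau>1 \<tau>2 t N1 N2)
  then show ?case using computation_cases_moves[of K c \<tau>s c'] by auto
qed

text \<open>At a branching, two transitions are enabled for the same state and symbols; determinism
  makes them equal although they write different bits. So the tree is one path and \<open>N\<close>
  is the value of its only leaf.\<close>

lemma unfolds_deterministic_output:
  assumes "unfolds K leaf c t N" and "deterministic K"
    and "\<And>c N. leaf c N \<Longrightarrow> \<exists>\<tau>s c' y. computation K c \<tau>s c' \<and> halted K c' \<and> has_output c' y \<and>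
      N = int (binary_value y)"
  shows "\<exists>\<tau>s c' y. computation K c \<tau>s c' \<and> halted K c' \<and> has_output c' y \<and> N = int (binary_value y)"
  using assms(1)
proof (induction rule: unfolds.induct)
  case (unfolds_leaf c N t)
  then show ?case using assms(3) by blast
next
  case (unfolds_step c \<tau> t N)
  then obtain \<tau>s c' y where "computation K (fire \<tau> c) \<tau>s c'" "halted K c'" "has_output c' y"
    "N = int (binary_value y)" by blast
  moreover have "computation K c (\<tau> # \<tau>s) c'"
    using calculation unfolds_step(1) by (auto simp: moves_def)
  ultimately show ?case by blast
next
  case (unfolds_branch c \<tau>1 \<tau>2 t N1 N2)
  have "\<tau>1 = \<tau>2"
  proof -
    have "\<tau>1 \<in> transitions K" "\<tau>2 \<in> transitions K" "enabled c \<tau>1" "enabled c \<tau>2"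
      using unfolds_branch(1) by (auto simp: moves_def)
    then show ?thesis using assms(2)
      by (cases c; cases \<tau>1; cases \<tau>2) (auto simp: deterministic_def)
  qed
  then show ?case using unfolds_branch writes_unique by blast
qed

section \<open>Outputs of machines that only append to their output tape\<close>

definition append_only :: "ntm \<Rightarrow> bool" where
  "append_only K \<longleftrightarrow> (\<forall>(q, \<gamma>, q', \<alpha>) \<in> transitions K. \<gamma> \<noteq> [] \<and> length \<alpha> = length \<gamma> \<and>
     (last \<alpha> = (Blank, Stay) \<or> (\<exists>b. last \<alpha> = (Bit b, MoveR))) \<and> last \<gamma> = Blank)"

lemma read_written [simp]: "read (written z) = Blank"
  by (simp add: read_def written_def input_tape_def)

lemma act_written_stay [simp]: "act (Blank, Stay) (written z) = written z"
  by (auto simp: written_def input_tape_def)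

lemma act_written_append [simp]: "act (Bit b, MoveR) (written z) = written (z @ [b])"
  by (auto simp: written_def input_tape_def fun_eq_iff nth_append)

lemma last_map2:
  "length xs = length ys \<Longrightarrow> xs \<noteq> [] \<Longrightarrow> last (map2 f xs ys) = f (last xs) (last ys)"
  by (induction xs ys rule: list_induct2) auto

lemma fire_append_only:
  assumes "append_only K" "\<tau> \<in> moves K c" "last (snd c) = written z"
  shows "\<exists>y. last (snd (fire \<tau> c)) = written (z @ y)"
    and "writes \<tau> b \<Longrightarrow> last (snd (fire \<tau> c)) = written (z @ [b])"
proof -
  obtain p ts q \<gamma> q' \<alpha> where c: "c = (p, ts)" and \<tau>: "\<tau> = (q, \<gamma>, q', \<alpha>)" by (metis prod_cases4 surj_pair)
  have g: "\<gamma> = map read ts" "\<gamma> \<noteq> []" "length \<alpha> = length \<gamma>"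
    "last \<alpha> = (Blank, Stay) \<or> (\<exists>b. last \<alpha> = (Bit b, MoveR))"
    using assms(1,2) unfolding append_only_def moves_def c \<tau> by auto
  have "last (map2 act \<alpha> ts) = act (last \<alpha>) (last ts)"
    using g by (intro last_map2) auto
  then have e: "last (snd (fire \<tau> c)) = act (last \<alpha>) (written z)"
    using assms(3) by (simp add: c \<tau>)
  show "\<exists>y. last (snd (fire \<tau> c)) = written (z @ y)"
    using g(4)
  proof
    assume "last \<alpha> = (Blank, Stay)"
    then show ?thesis using e by (intro exI[of _ "[]"]) simp
  next
    assume "\<exists>b. last \<alpha> = (Bit b, MoveR)"
    then show ?thesis using e by auto
  qed
  show "writes \<tau> b \<Longrightarrow> last (snd (fire \<tau> c)) = written (z @ [b])"
    using e by (simp add: writes_def \<tau>)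
qed

lemma computation_append_only:
  assumes "append_only K" "computation K c \<tau>s c'" "last (snd c) = written z"
  shows "\<exists>y. last (snd c') = written (z @ y)"
  using assms(2,3)
proof (induction \<tau>s arbitrary: c z)
  case Nil
  then show ?case by (intro exI[of _ "[]"]) simp
next
  case (Cons \<tau> \<tau>s)
  then have "\<tau> \<in> moves K c" by (simp add: moves_def)
  then obtain y where "last (snd (fire \<tau> c)) = written (z @ y)"
    using fire_append_only(1)[OF assms(1)] Cons.prems(2) by blast
  then obtain y' where "last (snd c') = written ((z @ y) @ y')"
    using Cons.IH[of "fire \<tau> c" "z @ y"] Cons.prems by auto
  then show ?case by auto
qed

lemma has_output_written:
  assumes "last (snd c) = written z"
  shows "has_output c y \<longleftrightarrow> y = z"
proof
  assume h: "has_output c y"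
  have 1: "fst (written z) (int i) = Bit (y ! i)" if "i < length y" for i
    using h that assms by (simp add: has_output_def)
  have 2: "fst (written z) (int (length y)) \<noteq> Bit b" for b
    using h assms by (simp add: has_output_def)
  have le: "length y \<ge> length z"
    using 2[of "z ! length y"] by (auto simp: written_def input_tape_def split: if_splits)
  have 3: "i < length z \<and> y ! i = z ! i" if "i < length y" for i
    using 1[OF that] by (auto simp: written_def input_tape_def split: if_splits)
  have "length y = length z"
    using le 3[of "length z"] by (cases "length z < length y") auto
  then show "y = z"
    using 3 by (simp add: nth_equalityI)
next
  assume "y = z"
  then show "has_output c y"
    using assms by (simp add: has_output_def written_def input_tape_def)
qed

text \<open>Nothing recorded is ever overwritten. Hence branches that have recorded different bits
  have disjoint sets of outputs.\<close>

lemma outputs_extend: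
  assumes "append_only K" "last (snd c) = written z" "y \<in> outputs K c"
  shows "take (length z) y = z"
proof -
  obtain \<tau>s c' where "computation K c \<tau>s c'" "has_output c' y"
    using assms(3) by (auto simp: outputs_def)
  then show ?thesis
    using computation_append_only[OF assms(1) _ assms(2)] has_output_written by fastforce
qed

lemma unfolds_span:
  assumes "unfolds K leaf c t N" and K: "append_only K"
    and "\<And>c N. leaf c N \<Longrightarrow> finite (outputs K c) \<and> int (card (outputs K c)) = N"
    and "\<exists>z. last (snd c) = written z"
  shows "finite (outputs K c) \<and> int (card (outputs K c)) = N"
  using assms(1,4)
proof (induction rule: unfolds.induct)
  case (unfolds_leaf c N t)
  then show ?case using assms(3) by blast
next
  case (unfolds_step c \<tau> t N)
  then have "\<exists>z. last (snd (fire \<tau> c)) = written z"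
    using fire_append_only(1)[OF K, of \<tau> c] by (metis insertI1)
  then show ?case using unfolds_step by (simp add: outputs_unfold)
next
  case (unfolds_branch c \<tau>1 \<tau>2 t N1 N2)
  then obtain z where z: "last (snd c) = written z" by blast
  have 1: "last (snd (fire \<tau>1 c)) = written (z @ [False])"
    using fire_append_only(2)[OF K _ z] unfolds_branch by auto
  have 2: "last (snd (fire \<tau>2 c)) = written (z @ [True])"
    using fire_append_only(2)[OF K _ z] unfolds_branch by auto
  have "outputs K (fire \<tau>1 c) \<inter> outputs K (fire \<tau>2 c) = {}"
    using outputs_extend[OF K 1] outputs_extend[OF K 2] by fastforce
  moreover have "finite (outputs K (fire \<tau>1 c)) \<and> int (card (outputs K (fire \<tau>1 c))) = N1"
    using unfolds_branch.IH(1) 1 by blast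
  moreover have "finite (outputs K (fire \<tau>2 c)) \<and> int (card (outputs K (fire \<tau>2 c))) = N2"
    using unfolds_branch.IH(2) 2 by blast
  ultimately show ?case
    using unfolds_branch.hyps(1) by (simp add: outputs_unfold card_Un_disjoint)
qed

section \<open>The guessing machine\<close>

datatype mode = Decide | Generate | Pad

text \<open>\<open>to_nat\<close> turns these into machine states; the wrapper
  \<open>Simulate\<close> keeps the states of \<open>M\<close> apart from those of the guessing
  phase.\<close>

datatype state = Init | Skip | Tick mode bool nat | Rewind | Simulate nat

instance mode :: countable by countable_datatype
instance state :: countable by countable_datatype

type_synonym instruction = "state \<times> move \<times> (symbol \<times> move) \<times> bool option"

fun output_action :: "bool option \<Rightarrow> symbol \<times> move" where
  "output_action None = (Blank, Stay)"
| "output_action (Some b) = (Bit b, MoveR)"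

fun output_bits :: "bool option \<Rightarrow> bool list" where
  "output_bits None = []"
| "output_bits (Some b) = [b]"

lemma act_output_action [simp]: "act (output_action oo) (written z) = written (z @ output_bits oo)"
  by (cases oo) simp_all

text \<open>While \<open>M\<close> runs, the input head is parked on the blank cell left of the
  input and the output head on the blank cell after the record; hence the two added blanks.\<close>

fun lift_transition :: "transition \<Rightarrow> transition" where
  "lift_transition (q, \<gamma>, q', \<alpha>) = (to_nat (Simulate q), Blank # \<gamma> @ [Blank],
     to_nat (Simulate q'), (Blank, Stay) # \<alpha> @ [(Blank, Stay)])"

text \<open>
  The tapes are the input tape, the tapes of \<open>M\<close>, and an output tape recording the guesses.
  On input \<open>1\<^sup>r0w\<close> the machine generates a string \<open>x\<close> on the first tape of \<open>M\<close> in a sequence of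
  ticks, one for each bit of \<open>w\<close> and then, in a leftward sweep over the whole input, \<open>B\<close> for each
  cell; the third component of \<open>Tick\<close> is the number of past ticks modulo \<open>B\<close>, the second one tells
  whether the sweep has begun. Until it decides to stop, the machine copies the current bit of
  \<open>w\<close>, guessing a dummy bit, or guesses a bit of \<open>x\<close> during the sweep. After that decision it
  guesses a dummy bit in those ticks \<open>i\<close> for which \<open>\<beta> i\<close> holds. Finally it runs \<open>M\<close> on \<open>x\<close>.
  With \<open>det\<close>, the machine pads from the beginning and all dummy bits are 0.
\<close>
locale guesser =
  fixes det :: bool and \<beta> :: "nat \<Rightarrow> bool" and B :: nat and M :: ntm
  assumes B_pos: "0 < B" and M_ntm: "ntm M" and \<beta>_periodic: "\<And>i. \<beta> (i mod B) = \<beta> i"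
begin

text \<open>The counter is also the phase of \<open>\<beta>\<close>, so it is not reset when the
  sweep begins. The first cell of the sweep therefore gets fewer than \<open>B\<close> ticks unless
  \<open>B\<close> divides the length of \<open>w\<close>.\<close>

definition tick_move :: "bool \<Rightarrow> nat \<Rightarrow> move" where
  "tick_move sweep j = (if sweep then (if Suc j mod B = 0 then MoveL else Stay) else MoveR)"

definition first_tick :: state where
  "first_tick = Tick (if det then Pad else Decide) False 0"

text \<open>An instruction consists of the new state, the move on the input tape, the action on the
  first tape of \<open>M\<close> and the recorded bit, if any. The \<open>True\<close> written by
  \<open>Init\<close> becomes the leading digit of the numeral printed by the deterministic variant.
  \<open>Generate\<close> is a mode of its own because deciding to go on and guessing a bit are two
  binary branchings, each with its own recorded bit.\<close>

fun all_instructions :: "state \<Rightarrow> symbol \<Rightarrow> symbol \<Rightarrow> instruction list" where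
  "all_instructions Init \<sigma> \<xi> = [(Skip, Stay, (Blank, Stay), Some True)]"
| "all_instructions Skip \<sigma> \<xi> = (case \<sigma> of
      Blank \<Rightarrow> [(first_tick, Stay, (Blank, Stay), None)]
    | Bit b \<Rightarrow> [(if b then Skip else first_tick, MoveR, (Blank, Stay), None)]
    | Mark _ \<Rightarrow> [])"
| "all_instructions (Tick m sweep j) \<sigma> \<xi> = (case \<sigma> of
      Blank \<Rightarrow> (if sweep then [(Rewind, Stay, (Blank, MoveL), None)]
                else [(Tick m True j, MoveL, (Blank, Stay), None)])
    | Bit b \<Rightarrow> (case m of
        Decide \<Rightarrow> [(Tick Generate sweep j, Stay, (Blank, Stay), Some False),
                   (Tick Pad sweep j, Stay, (Blank, Stay), Some True)]
      | Generate \<Rightarrow> [(Tick Decide sweep (Suc j mod B), tick_move sweep j,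
                       (Bit (if sweep then e else b), MoveR), Some e). e \<leftarrow> [False, True]]
      | Pad \<Rightarrow> [(Tick Pad sweep (Suc j mod B), tick_move sweep j, (Blank, Stay), e).
                 e \<leftarrow> if \<beta> j then [Some False, Some True] else [None]])
    | Mark _ \<Rightarrow> [])"
| "all_instructions Rewind \<sigma> \<xi> = (case \<xi> of
      Blank \<Rightarrow> [(Simulate (start M), Stay, (Blank, MoveR), None)]
    | _ \<Rightarrow> [(Rewind, Stay, (\<xi>, MoveL), None)])"
| "all_instructions (Simulate q) \<sigma> \<xi> = []"

definition instructions :: "state \<Rightarrow> symbol \<Rightarrow> symbol \<Rightarrow> instruction list" where
  "instructions q \<sigma> \<xi> = (if det then take 1 (all_instructions q \<sigma> \<xi>) else all_instructions q \<sigma> \<xi>)"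

definition guess_states :: "state set" where
  "guess_states = {Init, Skip, Rewind} \<union> (\<lambda>(m, sweep, j). Tick m sweep j) ` ({Decide, Generate, Pad} \<times> UNIV \<times> {..<B})"

definition guess_symbols :: "symbol set" where
  "guess_symbols = {Blank, Bit False, Bit True}"

fun guess_transition :: "state \<Rightarrow> symbol \<Rightarrow> symbol \<Rightarrow> instruction \<Rightarrow> transition" where
  "guess_transition q \<sigma> \<xi> (q', mv, xa, oo) =
     (to_nat q, \<sigma> # \<xi> # replicate (ntapes M - 1) Blank @ [Blank],
      to_nat q', (\<sigma>, mv) # xa # replicate (ntapes M - 1) (Blank, Stay) @ [output_action oo])"

definition guess_transitions :: "transition set" where
  "guess_transitions = (\<Union>q\<in>guess_states. \<Union>\<sigma>\<in>guess_symbols. \<Union>\<xi>\<in>guess_symbols.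
     guess_transition q \<sigma> \<xi> ` set (instructions q \<sigma> \<xi>))"

definition machine :: ntm where
  "machine = \<lparr>ntapes = ntapes M + 2, start = to_nat Init,
     accepting = (\<lambda>q. to_nat (Simulate q)) ` accepting M,
     transitions = guess_transitions \<union> lift_transition ` transitions M\<rparr>"

lemma M_ntapes_pos: "0 < ntapes M"
  using M_ntm by (simp add: ntm_def)

lemma guess_transition_lengths:
  "(q, \<gamma>, q', \<alpha>) = guess_transition q0 \<sigma> \<xi> e \<Longrightarrow> length \<gamma> = ntapes M + 2 \<and> length \<alpha> = ntapes M + 2"
  using M_ntapes_pos by (cases e) auto

lemma machine_ntm: "ntm machine"
proof -
  have "finite guess_transitions"
    by (auto simp: guess_transitions_def guess_states_def guess_symbols_def)
  moreover have "length \<gamma> = ntapes M + 2 \<and> length \<alpha> = ntapes M + 2"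
    if "(q, \<gamma>, q', \<alpha>) \<in> guess_transitions" for q \<gamma> q' \<alpha>
    using that guess_transition_lengths by (auto simp only: guess_transitions_def)
  moreover have "length \<gamma> = ntapes M + 2 \<and> length \<alpha> = ntapes M + 2"
    if "(q, \<gamma>, q', \<alpha>) \<in> lift_transition ` transitions M" for q \<gamma> q' \<alpha>
    using that M_ntm by (fastforce simp: ntm_def)
  ultimately show ?thesis
    using M_ntm unfolding ntm_def machine_def by (auto split: prod.splits)
qed

lemma machine_append_only: "append_only machine"
proof -
  have "\<gamma> \<noteq> [] \<and> length \<alpha> = length \<gamma> \<and> (last \<alpha> = (Blank, Stay) \<or> (\<exists>b. last \<alpha> = (Bit b, MoveR))) \<and>
      last \<gamma> = Blank" if "(q, \<gamma>, q', \<alpha>) = guess_transition q0 \<sigma> \<xi> e" for q \<gamma> q' \<alpha> q0 \<sigma> \<xi> e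
  proof -
    obtain r mv xa oo where "e = (r, mv, xa, oo)" by (metis prod_cases4)
    then show ?thesis using that by (cases oo) auto
  qed
  moreover have "\<gamma> \<noteq> [] \<and> length \<alpha> = length \<gamma> \<and> last \<alpha> = (Blank, Stay) \<and> last \<gamma> = Blank"
    if "(q, \<gamma>, q', \<alpha>) \<in> lift_transition ` transitions M" for q \<gamma> q' \<alpha>
    using that M_ntm by (fastforce simp: ntm_def)
  ultimately show ?thesis
    unfolding append_only_def machine_def guess_transitions_def by (auto simp del: guess_transition.simps lift_transition.simps) blast+
qed

text \<open>A guessing transition reveals the state and the two symbols it was built from, and
  \<open>take 1\<close> leaves at most one instruction for these.\<close>

lemma machine_deterministic:
  assumes det "transitions M = {}"
  shows "deterministic machine"
proof -
  have 1: "length (instructions q \<sigma> \<xi>) \<le> 1" for q \<sigma> \<xi>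
    unfolding instructions_def using assms(1) by simp
  have 2: "e = e'" if "e \<in> set (instructions q \<sigma> \<xi>)" "e' \<in> set (instructions q \<sigma> \<xi>)" for q \<sigma> \<xi> e e'
    using that 1[of q \<sigma> \<xi>] by (cases "instructions q \<sigma> \<xi>") auto
  show ?thesis
    unfolding deterministic_def
  proof (intro allI impI)
    fix q \<gamma> q1 \<alpha>1 q2 \<alpha>2
    assume "(q, \<gamma>, q1, \<alpha>1) \<in> transitions machine" "(q, \<gamma>, q2, \<alpha>2) \<in> transitions machine"
    then have m: "(q, \<gamma>, q1, \<alpha>1) \<in> guess_transitions" "(q, \<gamma>, q2, \<alpha>2) \<in> guess_transitions"
      by (simp_all add: machine_def assms(2))
    obtain p \<sigma> \<xi> e where e: "e \<in> set (instructions p \<sigma> \<xi>)"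
      and t: "(q, \<gamma>, q1, \<alpha>1) = guess_transition p \<sigma> \<xi> e"
      using m(1) by (auto simp only: guess_transitions_def)
    obtain p' \<sigma>' \<xi>' e' where e': "e' \<in> set (instructions p' \<sigma>' \<xi>')"
      and t': "(q, \<gamma>, q2, \<alpha>2) = guess_transition p' \<sigma>' \<xi>' e'"
      using m(2) by (auto simp only: guess_transitions_def)
    have "p' = p" "\<sigma>' = \<sigma>" "\<xi>' = \<xi>"
      using t t' by (cases e; cases e'; auto)+
    then show "q1 = q2 \<and> \<alpha>1 = \<alpha>2"
      using 2 e e' t t' by (metis Pair_inject)
  qed
qed

definition guess_config :: "state \<Rightarrow> (int \<Rightarrow> symbol) \<Rightarrow> int \<Rightarrow> tape \<Rightarrow> bool list \<Rightarrow> config" where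
  "guess_config q c p xt z = (to_nat q, (c, p) # xt # replicate (ntapes M - 1) blank_tape @ [written z])"

lemma read_blank_tape [simp]: "read blank_tape = Blank"
  by (simp add: read_def blank_tape_def)

lemma act_blank_tape [simp]: "act (Blank, Stay) blank_tape = blank_tape"
  by (simp add: blank_tape_def fun_eq_iff)

text \<open>Counting needs all moves, hence an equality. Injectivity of \<open>to_nat\<close>
  excludes lifted transitions and those of other guessing states.\<close>

lemma moves_guess_config:
  assumes "q \<in> guess_states" "c p \<in> guess_symbols" "read xt \<in> guess_symbols"
  shows "moves machine (guess_config q c p xt z) =
    guess_transition q (c p) (read xt) ` set (instructions q (c p) (read xt))" (is "?L = ?R")
proof
  have "enabled (guess_config q c p xt z) (guess_transition q (c p) (read xt) e)" for e
    by (cases e) (simp add: guess_config_def read_def[of "(c, p)"])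
  then show "?R \<subseteq> ?L"
    using assms by (auto simp: moves_def machine_def guess_transitions_def)
  show "?L \<subseteq> ?R"
  proof
    fix \<tau> assume "\<tau> \<in> ?L"
    then have e: "enabled (guess_config q c p xt z) \<tau>"
      and "\<tau> \<in> guess_transitions \<or> \<tau> \<in> lift_transition ` transitions M"
      by (auto simp: moves_def machine_def)
    moreover have "\<tau> \<notin> lift_transition ` transitions M"
      using e assms(1) by (auto simp: guess_config_def guess_states_def)
    ultimately obtain q0 \<sigma> \<xi> i where i: "i \<in> set (instructions q0 \<sigma> \<xi>)" and \<tau>: "\<tau> = guess_transition q0 \<sigma> \<xi> i"
      by (auto simp only: guess_transitions_def)
    have "q0 = q" "\<sigma> = c p" "\<xi> = read xt"
      using e unfolding \<tau> by (cases i; auto simp: guess_config_def read_def[of "(c, p)"])+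
    then show "\<tau> \<in> ?R" using i \<tau> by blast
  qed
qed

lemma map2_replicate: "map2 f (replicate n a) (replicate n b) = replicate n (f a b)"
  by (induction n) simp_all

lemma fire_guess_transition:
  "fire (guess_transition q (c p) \<xi> (q', mv, xa, oo)) (guess_config q c p xt z) =
    guess_config q' c (p + displacement mv) (act xa xt) (z @ output_bits oo)"
  by (simp add: guess_config_def map2_replicate zip_append)

lemma unfolds_guess_step:
  assumes "instructions q (c p) (read xt) = [(q', mv, xa, oo)]"
    and "q \<in> guess_states" "c p \<in> guess_symbols" "read xt \<in> guess_symbols"
    and "unfolds machine leaf (guess_config q' c (p + displacement mv) (act xa xt) (z @ output_bits oo)) t N"
  shows "unfolds machine leaf (guess_config q c p xt z) (Suc t) N"
  using moves_guess_config[of q c p xt z, OF assms(2-4)] assms(1,5)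
  by (intro unfolds_step) (auto simp: fire_guess_transition simp del: guess_transition.simps)

lemma unfolds_guess_branch:
  assumes "instructions q (c p) (read xt) = [(q1, mv1, xa1, Some False), (q2, mv2, xa2, Some True)]"
    and "q \<in> guess_states" "c p \<in> guess_symbols" "read xt \<in> guess_symbols"
    and "unfolds machine leaf (guess_config q1 c (p + displacement mv1) (act xa1 xt) (z @ [False])) t N1"
    and "unfolds machine leaf (guess_config q2 c (p + displacement mv2) (act xa2 xt) (z @ [True])) t N2"
  shows "unfolds machine leaf (guess_config q c p xt z) (Suc t) (N1 + N2)"
proof (rule unfolds_branch)
  show "moves machine (guess_config q c p xt z) =
    {guess_transition q (c p) (read xt) (q1, mv1, xa1, Some False),
     guess_transition q (c p) (read xt) (q2, mv2, xa2, Some True)}"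
    using moves_guess_config[of q c p xt z, OF assms(2-4)] assms(1) by (simp del: guess_transition.simps)
qed (use assms(5,6) in \<open>simp_all add: writes_def fire_guess_transition del: guess_transition.simps\<close>,
     simp_all add: writes_def)

end

section \<open>Weighted counts along the guessing tree\<close>

definition cost :: "(nat \<Rightarrow> bool) \<Rightarrow> nat \<Rightarrow> nat" where
  "cost \<beta> n = (\<Sum>i<n. of_bool (\<beta> i))"

lemma cost_Suc [simp]: "cost \<beta> (Suc n) = cost \<beta> n + of_bool (\<beta> n)"
  by (simp add: cost_def)

lemma cost_mono: "m \<le> n \<Longrightarrow> cost \<beta> m \<le> cost \<beta> n"
  unfolding cost_def by (intro sum_mono2) auto

text \<open>
  For the indicator function \<open>h\<close> of \<open>A\<close>, \<open>extension_sum h n w []\<close> is \<open>2\<^sup>|\<^sup>w\<^sup>|\<close> times the number of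
  extensions of \<open>w\<close> in \<open>A\<^sub>=\<^sub>n\<close> if \<open>n \<ge> |w|\<close>, and \<open>2\<^sup>n\<close> or 0 if \<open>n \<le> |w|\<close>, depending on whether the
  prefix of \<open>w\<close> of length \<open>n\<close> belongs to \<open>A\<close>.
\<close>
fun extension_sum :: "(bool list \<Rightarrow> int) \<Rightarrow> nat \<Rightarrow> bool list \<Rightarrow> bool list \<Rightarrow> int" where
  "extension_sum h 0 v x = h x"
| "extension_sum h (Suc n) (b # v) x = 2 * extension_sum h n v (x @ [b])"
| "extension_sum h (Suc n) [] x = extension_sum h n [] (x @ [False]) + extension_sum h n [] (x @ [True])"

text \<open>The situation after \<open>i\<close> ticks, with \<open>T\<close> to come,
  \<open>x\<close> generated and \<open>v\<close> left of \<open>w\<close>. Term \<open>n\<close>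
  collects the runs that stop after \<open>n\<close> more ticks; the power of 2 counts the dummy
  bits guessed after the stop.\<close>

definition guess_sum :: "(nat \<Rightarrow> bool) \<Rightarrow> (bool list \<Rightarrow> int) \<Rightarrow> nat \<Rightarrow> bool list \<Rightarrow> nat \<Rightarrow> bool list \<Rightarrow> int" where
  "guess_sum \<beta> h i v T x =
     (\<Sum>n\<le>T. 2 ^ (cost \<beta> (i + T) - cost \<beta> (i + n)) * extension_sum h n v x)"

lemma guess_sum_0: "guess_sum \<beta> h i v 0 x = h x"
  by (simp add: guess_sum_def)

text \<open>The term \<open>n = 0\<close>, stopping at once, is split off. All other runs copy
  \<open>b\<close> and guess a dummy bit; the two equal summands are kept apart to match the two
  branches of the machine.\<close>

lemma guess_sum_Cons:
  "guess_sum \<beta> h i (b # v) (Suc T) x =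
    guess_sum \<beta> h (Suc i) v T (x @ [b]) + guess_sum \<beta> h (Suc i) v T (x @ [b]) +
    2 ^ (cost \<beta> (i + Suc T) - cost \<beta> i) * h x"
  unfolding guess_sum_def sum.atMost_Suc_shift
  by (simp add: sum_distrib_left mult_ac del: cost_Suc)

lemma guess_sum_Nil:
  "guess_sum \<beta> h i [] (Suc T) x =
    guess_sum \<beta> h (Suc i) [] T (x @ [False]) + guess_sum \<beta> h (Suc i) [] T (x @ [True]) +
    2 ^ (cost \<beta> (i + Suc T) - cost \<beta> i) * h x"
  unfolding guess_sum_def sum.atMost_Suc_shift
  by (simp add: sum.distrib algebra_simps del: cost_Suc)

text \<open>Follows the padding phase tick by tick. The recorded string \<open>z\<close> is carried
  along because the deterministic variant takes its result from it.\<close>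

primrec pad_sum :: "bool \<Rightarrow> (nat \<Rightarrow> bool) \<Rightarrow> (bool list \<Rightarrow> int) \<Rightarrow> nat \<Rightarrow> nat \<Rightarrow> bool list \<Rightarrow> int" where
  "pad_sum det \<beta> h i 0 z = h z"
| "pad_sum det \<beta> h i (Suc T) z =
    (if \<beta> i then if det then pad_sum det \<beta> h (Suc i) T (z @ [False])
                 else pad_sum det \<beta> h (Suc i) T (z @ [False]) + pad_sum det \<beta> h (Suc i) T (z @ [True])
     else pad_sum det \<beta> h (Suc i) T z)"

lemma pad_sum_det: "pad_sum True \<beta> h i T z = h (z @ replicate (cost \<beta> (i + T) - cost \<beta> i) False)"
proof (induction T arbitrary: i z)
  case (Suc T)
  have "cost \<beta> (i + Suc T) - cost \<beta> i = of_bool (\<beta> i) + (cost \<beta> (Suc i + T) - cost \<beta> (Suc i))"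
    using cost_mono[of "Suc i" "Suc i + T" \<beta>] by simp
  then show ?case using Suc by (simp del: cost_Suc)
qed simp

lemma pad_sum_const:
  "pad_sum False \<beta> (\<lambda>_. a) i T z = 2 ^ (cost \<beta> (i + T) - cost \<beta> i) * a"
proof (induction T arbitrary: i z)
  case (Suc T)
  have "cost \<beta> (i + Suc T) - cost \<beta> i = of_bool (\<beta> i) + (cost \<beta> (Suc i + T) - cost \<beta> (Suc i))"
    using cost_mono[of "Suc i" "Suc i + T" \<beta>] by simp
  then show ?case using Suc by (simp del: cost_Suc)
qed simp

text \<open>Defined on malformed inputs too, since time bounds concern every input; a string without
  a 0 has payload \<open>[]\<close>.\<close>

definition payload :: "bool list \<Rightarrow> bool list" where
  "payload u = tl (dropWhile id u)"

text \<open>One tick per bit of the payload, then \<open>B\<close> per cell of the input, less the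
  value that the counter already has when the sweep begins.\<close>

definition ticks :: "nat \<Rightarrow> bool list \<Rightarrow> nat" where
  "ticks B u = length (payload u) + (B * length u - length (payload u) mod B)"

lemma length_payload_le: "length (payload u) \<le> length u"
  unfolding payload_def using length_dropWhile_le[of id u] by simp

lemma ticks_bounds: "B * length u \<le> ticks B u" "ticks B u \<le> (B + 1) * length u"
  unfolding ticks_def add_mult_distrib
  using length_payload_le[of u] mod_less_eq_dividend[of "length (payload u)" B] by linarith+

section \<open>Runs of the guessing machine up to the start of the simulation\<close>

context guesser
begin

lemma instructions_single:
  assumes "all_instructions q \<sigma> \<xi> = [e]"
  shows "instructions q \<sigma> \<xi> = [e]"
  unfolding instructions_def assms by simp

lemma instructions_det: "det \<Longrightarrow> all_instructions q \<sigma> \<xi> = e # es \<Longrightarrow> instructions q \<sigma> \<xi> = [e]"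
  unfolding instructions_def by simp

lemma instructions_nondet: "\<not> det \<Longrightarrow> instructions q \<sigma> \<xi> = all_instructions q \<sigma> \<xi>"
  unfolding instructions_def by simp

definition cells :: "bool list \<Rightarrow> int \<Rightarrow> symbol" where
  "cells u = fst (input_tape u)"

lemma cells_in_symbols: "cells u p \<in> guess_symbols"
  by (cases "u ! nat p") (auto simp: cells_def input_tape_def guess_symbols_def)

lemma cells_outside: "p < 0 \<or> int (length u) \<le> p \<Longrightarrow> cells u p = Blank"
  by (auto simp: cells_def input_tape_def)

lemma cells_inside: "0 \<le> p \<Longrightarrow> p < int (length u) \<Longrightarrow> cells u p = Bit (u ! nat p)"
  by (auto simp: cells_def input_tape_def)

lemma blank_in_symbols [simp]: "Blank \<in> guess_symbols"
  by (simp add: guess_symbols_def)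

lemma Tick_in_states: "j < B \<Longrightarrow> Tick m sweep j \<in> guess_states"
  unfolding guess_states_def
  by (rule UnI2, rule image_eqI[of _ _ "(m, sweep, j)"]) (cases m; auto)+

text \<open>The moment when \<open>M\<close> is about to start on the guessed \<open>x\<close>. The
  bound \<open>X\<close> on its length is what makes the running time of \<open>M\<close> polynomial
  in the length of \<open>u\<close>.\<close>

definition leaf :: "bool list \<Rightarrow> (bool list \<Rightarrow> bool list \<Rightarrow> int) \<Rightarrow> nat \<Rightarrow> config \<Rightarrow> int \<Rightarrow> bool" where
  "leaf u h X c N \<longleftrightarrow> (\<exists>x z. length x \<le> X \<and>
     c = guess_config (Simulate (start M)) (cells u) (- 1) (input_tape x) z \<and> N = h x z)"

lemma unfolds_rewind:
  assumes "k \<le> length x" "length x \<le> X"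
  shows "unfolds machine (leaf u h X)
    (guess_config Rewind (cells u) (- 1) (cells x, int k - 1) z) (Suc k) (h x z)"
  using assms(1)
proof (induction k)
  case 0
  have r: "read (cells x, - 1) = Blank" by (simp add: read_def cells_outside)
  have a: "act (Blank, MoveR) (cells x, - 1) = input_tape x"
    by (auto simp: cells_def input_tape_def)
  have "unfolds machine (leaf u h X)
    (guess_config Rewind (cells u) (- 1) (cells x, - 1) z) (Suc 0) (h x z)"
    using assms(2)
    by - (rule unfolds_guess_step[where q' = "Simulate (start M)" and mv = Stay and
          xa = "(Blank, MoveR)" and oo = None],
      (auto simp: r a instructions_single cells_in_symbols guess_states_def leaf_def simp del: act.simps
        intro!: unfolds_leaf exI)+)
  then show ?case by simp
next
  case (Suc k)
  have r: "read (cells x, int k) = Bit (x ! k)" using Suc by (simp add: read_def cells_inside)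
  have a: "act (Bit (x ! k), MoveL) (cells x, int k) = (cells x, int k - 1)"
    using Suc cells_inside[of "int k" x] by (auto simp: fun_eq_iff)
  have s: "Bit (x ! k) \<in> guess_symbols" by (cases "x ! k") (auto simp: guess_symbols_def)
  have "unfolds machine (leaf u h X)
    (guess_config Rewind (cells u) (- 1) (cells x, int k) z) (Suc (Suc k)) (h x z)"
    using Suc
    by - (rule unfolds_guess_step[where q' = Rewind and mv = Stay and
          xa = "(Bit (x ! k), MoveL)" and oo = None],
      (auto simp: r a s instructions_single cells_in_symbols guess_states_def simp del: act.simps)+)
  then show ?case by simp
qed

lemma unfolds_sweep_end:
  assumes "m \<noteq> Generate" "j < B" "length x \<le> X"
  shows "unfolds machine (leaf u h X)
    (guess_config (Tick m True j) (cells u) (- 1) (written x) z) (X + 2) (h x z)"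
proof -
  have a: "act (Blank, MoveL) (written x) = (cells x, int (length x) - 1)"
    by (auto simp: written_def cells_def input_tape_def)
  have "unfolds machine (leaf u h X)
    (guess_config (Tick m True j) (cells u) (- 1) (written x) z) (Suc (Suc (length x))) (h x z)"
    using unfolds_rewind[of "length x" x X u h z] assms
    by - (rule unfolds_guess_step[where q' = Rewind and mv = Stay and
          xa = "(Blank, MoveL)" and oo = None],
      (auto simp: a instructions_single cells_outside Tick_in_states simp del: act.simps)+)
  then show ?thesis
    by (rule unfolds_mono) (use assms in simp)
qed

lemma unfolds_pad_tick:
  assumes "0 \<le> p" "p < int (length u)" "j = i mod B"
    and "\<And>z. unfolds machine lf (guess_config (Tick Pad sweep (Suc i mod B)) (cells u)
      (p + displacement (tick_move sweep j)) (written x) z) t (pad_sum det \<beta> (h x) (Suc i) T z)"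
  shows "unfolds machine lf (guess_config (Tick Pad sweep j) (cells u) p (written x) z)
      (Suc t) (pad_sum det \<beta> (h x) i (Suc T) z)"
proof -
  note c = cells_inside[OF assms(1,2)]
  have j: "Suc j mod B = Suc i mod B" "j < B" "\<beta> j = \<beta> i"
    using B_pos \<beta>_periodic by (auto simp: assms(3) mod_Suc_eq)
  note u = assms(4)
  show ?thesis
  \<comment> \<open>Only in this case is a dummy bit really guessed; otherwise there is a single
    move, which writes at most a forced 0.\<close>
  proof (cases "\<beta> i \<and> \<not> det")
    case True
    then have "pad_sum det \<beta> (h x) i (Suc T) z =
      pad_sum det \<beta> (h x) (Suc i) T (z @ [False]) + pad_sum det \<beta> (h x) (Suc i) T (z @ [True])"
      by simp
    moreover have "instructions (Tick Pad sweep j) (cells u p) (read (written x)) =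
      [(Tick Pad sweep (Suc i mod B), tick_move sweep j, (Blank, Stay), Some False),
       (Tick Pad sweep (Suc i mod B), tick_move sweep j, (Blank, Stay), Some True)]"
      by (subst instructions_nondet)
        (use True in blast, use conjunct1[OF True] j in \<open>simp add: c\<close>)
    ultimately show ?thesis
      using j u by - (simp only:, rule unfolds_guess_branch,
        (auto simp: cells_in_symbols Tick_in_states simp del: act.simps)+)
  next
    case False
    define oo where "oo = (if \<beta> i then Some False else None)"
    have "pad_sum det \<beta> (h x) i (Suc T) z = pad_sum det \<beta> (h x) (Suc i) T (z @ output_bits oo)"
      using False by (auto simp: oo_def)
    moreover have "instructions (Tick Pad sweep j) (cells u p) (read (written x)) =
      [(Tick Pad sweep (Suc i mod B), tick_move sweep j, (Blank, Stay), oo)]"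
    proof (cases "\<beta> i")
      case True
      then have det using False by blast
      then show ?thesis
        by (rule instructions_det) (use True j in \<open>simp add: c oo_def\<close>)
    qed (use j in \<open>simp add: instructions_single c oo_def\<close>)
    ultimately show ?thesis
      using j u by - (simp only:, rule unfolds_guess_step,
        (auto simp: cells_in_symbols Tick_in_states simp del: act.simps)+)
  qed
qed

text \<open>With the head on cell \<open>p\<close> and the counter at \<open>j\<close>,
  \<open>B * (p + 1) - j\<close> ticks are left. A tick lowers this by one, whether the counter
  advances or wraps while the head moves left.\<close>

lemma sweep_tick:
  assumes "int (Suc T) = int B * (p + 1) - int j" "j < B" "- 1 \<le> p"
  shows "0 \<le> p" "int T = int B * (p + displacement (tick_move True j) + 1) - int (Suc j mod B)"
    "- 1 \<le> p + displacement (tick_move True j)" "p + displacement (tick_move True j) \<le> p"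
proof -
  show p: "0 \<le> p"
  proof (rule ccontr)
    assume "\<not> 0 \<le> p"
    then have "p = - 1" using assms(3) by simp
    then show False using assms(1) by simp
  qed
  show "int T = int B * (p + displacement (tick_move True j) + 1) - int (Suc j mod B)"
  proof (cases "Suc j = B")
    case True
    then show ?thesis using assms by (auto simp: tick_move_def algebra_simps)
  next
    case False
    then show ?thesis using assms by (auto simp: tick_move_def algebra_simps)
  qed
  show "- 1 \<le> p + displacement (tick_move True j)" "p + displacement (tick_move True j) \<le> p"
    using p by (auto simp: tick_move_def)
qed

lemma sweep_0:
  assumes "int 0 = int B * (p + 1) - int j" "j < B" "- 1 \<le> p"
  shows "p = - 1"
proof (rule ccontr)
  assume "p \<noteq> - 1"
  then have "int B \<le> int B * (p + 1)"
    using assms(3) mult_left_mono[of 1 "p + 1" "int B"] by simp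
  then show False using assms(1,2) by linarith
qed

lemma unfolds_pad_sweep:
  assumes "length x \<le> X" "- 1 \<le> p" "p < int (length u)"
    and "int T = int B * (p + 1) - int (i mod B)"
  shows "unfolds machine (leaf u h X) (guess_config (Tick Pad True (i mod B)) (cells u) p (written x) z)
    (T + X + 2) (pad_sum det \<beta> (h x) i T z)"
  using assms(2-)
proof (induction T arbitrary: p i z)
  case 0
  then have "p = - 1" using sweep_0[of p "i mod B"] B_pos by simp
  then show ?case using unfolds_sweep_end[of Pad "i mod B" x X u h z] assms(1) B_pos by simp
next
  case (Suc T)
  have j: "i mod B < B" using B_pos by simp
  note s = sweep_tick[OF Suc.prems(3) j Suc.prems(1)]
  have "unfolds machine (leaf u h X) (guess_config (Tick Pad True (Suc i mod B)) (cells u)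
      (p + displacement (tick_move True (i mod B))) (written x) z) (T + X + 2) (pad_sum det \<beta> (h x) (Suc i) T z)" for z
    using s Suc.prems(2) by (intro Suc.IH) (auto simp: mod_Suc_eq)
  then show ?case
    using unfolds_pad_tick[OF s(1) Suc.prems(2) refl, where sweep = True and t = "T + X + 2"] by simp
qed

text \<open>A run that stops while \<open>w\<close> is still being read must use up the remaining
  ticks all the same, to get the weight demanded by the common denominator. \<open>T\<close> is the
  length of the sweep to follow.\<close>

lemma unfolds_pad_copy:
  assumes "length x \<le> X" "u = pre @ v"
    and "int T = int B * int (length u) - int ((i + length v) mod B)"
  shows "unfolds machine (leaf u h X)
    (guess_config (Tick Pad False (i mod B)) (cells u) (int (length pre)) (written x) z)
    (length v + T + X + 3) (pad_sum det \<beta> (h x) i (length v + T) z)"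
  using assms(2,3)
proof (induction v arbitrary: pre i z)
  case Nil
  have "unfolds machine (leaf u h X)
    (guess_config (Tick Pad True (i mod B)) (cells u) (int (length pre) - 1) (written x) z)
    (T + X + 2) (pad_sum det \<beta> (h x) i T z)"
    using Nil by (intro unfolds_pad_sweep) (auto simp: assms(1))
  then have "unfolds machine (leaf u h X)
    (guess_config (Tick Pad False (i mod B)) (cells u) (int (length pre)) (written x) z)
    (Suc (T + X + 2)) (pad_sum det \<beta> (h x) i T z)"
    using Nil B_pos
    by - (rule unfolds_guess_step[where q' = "Tick Pad True (i mod B)" and mv = MoveL and
          xa = "(Blank, Stay)" and oo = None],
      (auto simp: instructions_single cells_outside Tick_in_states simp del: act.simps)+)
  then show ?case by (simp add: eval_nat_numeral)
next
  case (Cons b v)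
  have "unfolds machine (leaf u h X)
    (guess_config (Tick Pad False (Suc i mod B)) (cells u) (int (length (pre @ [b]))) (written x) z)
    (length v + T + X + 3) (pad_sum det \<beta> (h x) (Suc i) (length v + T) z)" for z
    using Cons.prems by (intro Cons.IH) auto
  then show ?case
    using unfolds_pad_tick[where sweep = False and u = u and i = i and j = "i mod B" and
       p = "int (length pre)" and t = "length v + T + X + 3" and T = "length v + T"] Cons.prems
    by (auto simp: tick_move_def add.commute)
qed

text \<open>During the sweep \<open>e\<close> is the generated bit. While \<open>w\<close> is copied
  it is a mere dummy bit, and the lemma is applied with \<open>N False = N True\<close>.\<close>

lemma unfolds_decide_tick:
  assumes "\<not> det" "0 \<le> p" "p < int (length u)" "j = i mod B"
    and gen: "\<And>e z. unfolds machine lf (guess_config (Tick Decide sweep (Suc i mod B)) (cells u)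
      (p + displacement (tick_move sweep j)) (written (x @ [if sweep then e else u ! nat p])) z) t (N e)"
    and pad: "\<And>z. unfolds machine lf (guess_config (Tick Pad sweep j) (cells u) p (written x) z) (Suc t) N'"
  shows "unfolds machine lf (guess_config (Tick Decide sweep j) (cells u) p (written x) z)
      (Suc (Suc t)) (N False + N True + N')"
proof -
  note c = cells_inside[OF assms(2,3)]
  have j: "Suc j mod B = Suc i mod B" "j < B"
    using B_pos by (auto simp: assms(4) mod_Suc_eq)
  have d: "instructions (Tick Decide sweep j) (cells u p) (read (written x)) =
    [(Tick Generate sweep j, Stay, (Blank, Stay), Some False),
     (Tick Pad sweep j, Stay, (Blank, Stay), Some True)]"
    by (subst instructions_nondet[OF assms(1)]) (simp add: c)
  have g: "instructions (Tick Generate sweep j) (cells u p) (read (written x)) =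
    [(Tick Decide sweep (Suc i mod B), tick_move sweep j,
       (Bit (if sweep then False else u ! nat p), MoveR), Some False),
     (Tick Decide sweep (Suc i mod B), tick_move sweep j,
       (Bit (if sweep then True else u ! nat p), MoveR), Some True)]"
    by (subst instructions_nondet[OF assms(1)]) (simp add: c j)
  have "unfolds machine lf (guess_config (Tick Generate sweep j) (cells u) p (written x) z)
      (Suc t) (N False + N True)" for z
    by (rule unfolds_guess_branch[where c = "cells u" and p = p, OF g])
      (use j gen[of False] gen[of True] in \<open>simp_all add: cells_in_symbols Tick_in_states del: act.simps\<close>)
  then show ?thesis
    using pad j
    by - (rule unfolds_guess_branch[where c = "cells u" and p = p, OF d], simp_all add: cells_in_symbols Tick_in_states del: act.simps)
qed

lemma unfolds_decide_sweep:
  assumes "\<not> det" and h: "h = (\<lambda>x _. h' x)"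
    and "length x + T \<le> X" "- 1 \<le> p" "p < int (length u)"
    and "int T = int B * (p + 1) - int (i mod B)"
  shows "unfolds machine (leaf u h X) (guess_config (Tick Decide True (i mod B)) (cells u) p (written x) z)
    (2 * T + X + 2) (guess_sum \<beta> h' i [] T x)"
  using assms(3-)
proof (induction T arbitrary: p i x z)
  case 0
  then have "p = - 1" using sweep_0[of p "i mod B"] B_pos by simp
  then show ?case
    using unfolds_sweep_end[of Decide "i mod B" x X u h z] 0 B_pos by (simp add: guess_sum_0 h)
next
  case (Suc T)
  have j: "i mod B < B" using B_pos by simp
  note s = sweep_tick[OF Suc.prems(4) j Suc.prems(2)]
  have 1: "unfolds machine (leaf u h X) (guess_config (Tick Decide True (Suc i mod B)) (cells u)
      (p + displacement (tick_move True (i mod B))) (written (x @ [if True then e else u ! nat p])) z)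
      (2 * T + X + 2) (guess_sum \<beta> h' (Suc i) [] T (x @ [e]))" for z e
    unfolding if_True using s Suc.prems(1,3) by (intro Suc.IH) (auto simp: mod_Suc_eq)
  have 2: "unfolds machine (leaf u h X) (guess_config (Tick Pad True (i mod B)) (cells u) p (written x) z)
      (Suc (2 * T + X + 2)) (2 ^ (cost \<beta> (i + Suc T) - cost \<beta> i) * h' x)" for z
  proof (rule unfolds_mono)
    have "pad_sum det \<beta> (h x) i (Suc T) z = 2 ^ (cost \<beta> (i + Suc T) - cost \<beta> i) * h' x"
      using assms(1) pad_sum_const[of \<beta> "h' x" i "Suc T" z] by (simp add: h)
    then show "unfolds machine (leaf u h X)
       (guess_config (Tick Pad True (i mod B)) (cells u) p (written x) z)
       (Suc T + X + 2) (2 ^ (cost \<beta> (i + Suc T) - cost \<beta> i) * h' x)"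
      using unfolds_pad_sweep[of x X p u "Suc T" i h z] Suc.prems by simp
  qed simp
  show ?case
    unfolding guess_sum_Nil
    using unfolds_decide_tick[OF assms(1) s(1) Suc.prems(3) refl 1 2] by simp
qed

lemma unfolds_decide_copy:
  assumes "\<not> det" and h: "h = (\<lambda>x _. h' x)"
    and "length x + (length v + T) \<le> X" "u = pre @ v"
    and "int T = int B * int (length u) - int ((i + length v) mod B)"
  shows "unfolds machine (leaf u h X)
    (guess_config (Tick Decide False (i mod B)) (cells u) (int (length pre)) (written x) z)
    (2 * (length v + T) + X + 3) (guess_sum \<beta> h' i v (length v + T) x)"
  using assms(3-)
proof (induction v arbitrary: pre i x z)
  case Nil
  have "unfolds machine (leaf u h X)
    (guess_config (Tick Decide True (i mod B)) (cells u) (int (length pre) - 1) (written x) z)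
    (2 * T + X + 2) (guess_sum \<beta> h' i [] T x)"
    using Nil by (intro unfolds_decide_sweep assms(1) h) auto
  then have "unfolds machine (leaf u h X)
    (guess_config (Tick Decide False (i mod B)) (cells u) (int (length pre)) (written x) z)
    (Suc (2 * T + X + 2)) (guess_sum \<beta> h' i [] T x)"
    using Nil B_pos
    by - (rule unfolds_guess_step[where q' = "Tick Decide True (i mod B)" and mv = MoveL and
          xa = "(Blank, Stay)" and oo = None],
      (auto simp: instructions_single cells_outside Tick_in_states simp del: act.simps)+)
  then show ?case by (simp add: eval_nat_numeral)
next
  case (Cons b v)
  have b: "u ! nat (int (length pre)) = b" using Cons.prems(2) by simp
  have p: "0 \<le> int (length pre)" "int (length pre) < int (length u)" using Cons.prems(2) by auto
  have "unfolds machine (leaf u h X)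
    (guess_config (Tick Decide False (Suc i mod B)) (cells u) (int (length (pre @ [b]))) (written (x @ [b])) z)
    (2 * (length v + T) + X + 3) (guess_sum \<beta> h' (Suc i) v (length v + T) (x @ [b]))" for z
    using Cons.prems by (intro Cons.IH) auto
  then have 1: "unfolds machine (leaf u h X)
    (guess_config (Tick Decide False (Suc i mod B)) (cells u)
      (int (length pre) + displacement (tick_move False (i mod B)))
      (written (x @ [if False then e else u ! nat (int (length pre))])) z)
    (2 * (length v + T) + X + 3) (guess_sum \<beta> h' (Suc i) v (length v + T) (x @ [b]))" for z e
    unfolding b by (simp add: tick_move_def add.commute)
  have 2: "unfolds machine (leaf u h X)
      (guess_config (Tick Pad False (i mod B)) (cells u) (int (length pre)) (written x) z)
      (Suc (2 * (length v + T) + X + 3))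
      (2 ^ (cost \<beta> (i + Suc (length v + T)) - cost \<beta> i) * h' x)" for z
  proof (rule unfolds_mono)
    have "pad_sum det \<beta> (h x) i (Suc (length v + T)) z =
        2 ^ (cost \<beta> (i + Suc (length v + T)) - cost \<beta> i) * h' x"
      using assms(1) pad_sum_const[of \<beta> "h' x" i "Suc (length v + T)" z] by (simp add: h)
    then show "unfolds machine (leaf u h X)
       (guess_config (Tick Pad False (i mod B)) (cells u) (int (length pre)) (written x) z)
       (length (b # v) + T + X + 3) (2 ^ (cost \<beta> (i + Suc (length v + T)) - cost \<beta> i) * h' x)"
      using unfolds_pad_copy[of x X u pre "b # v" T i h z] Cons.prems by simp
  qed simp
  show ?case
    using unfolds_decide_tick[OF assms(1) p refl 1 2] guess_sum_Cons[of \<beta> h' i b v "length v + T" x]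
    by simp
qed

text \<open>Includes inputs without a 0: there the head ends on the blank cell behind the input,
  which fits an empty payload.\<close>

lemma unfolds_skip:
  assumes "u = pre @ v"
    and "unfolds machine lf (guess_config first_tick (cells u)
      (int (length u) - int (length (tl (dropWhile id v)))) (written []) z) t N"
  shows "unfolds machine lf (guess_config Skip (cells u) (int (length pre)) (written []) z)
      (t + length v + 1) N"
  using assms
proof (induction v arbitrary: pre)
  case Nil
  then show ?case
    by - (simp, rule unfolds_guess_step[where q' = first_tick and mv = Stay and
          xa = "(Blank, Stay)" and oo = None],
      (auto simp: instructions_single cells_outside guess_states_def simp del: act.simps)+)
next
  case (Cons b v)
  have c: "cells u (int (length pre)) = Bit b"
    using Cons.prems(1) by (simp add: cells_inside)
  have "unfolds machine lf (guess_config (if b then Skip else first_tick) (cells u)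
      (int (length pre) + 1) (written []) z) (t + length v + 1) N"
  proof (cases b)
    case True
    then show ?thesis using Cons.IH[of "pre @ [b]"] Cons.prems by (simp add: add.commute)
  next
    case False
    then show ?thesis using Cons.prems by (auto intro: unfolds_mono simp: add.commute)
  qed
  then show ?case
    by - (simp, rule unfolds_guess_step[where q' = "if b then Skip else first_tick" and mv = MoveR and
          xa = "(Blank, Stay)" and oo = None],
      (simp_all add: instructions_single c guess_states_def guess_symbols_def del: act.simps))
qed

lemma initial_machine: "initial machine u = guess_config Init (cells u) 0 (written []) []"
proof -
  have "replicate (ntapes M + 1) blank_tape =
    blank_tape # replicate (ntapes M - 1) blank_tape @ [blank_tape]"
    using M_ntapes_pos by (cases "ntapes M") (simp_all add: replicate_append_same)
  moreover have "written [] = blank_tape"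
    by (auto simp: written_def blank_tape_def input_tape_def)
  ultimately show ?thesis
    by (simp add: initial_def guess_config_def machine_def cells_def input_tape_def)
qed

text \<open>In the deterministic variant nothing is generated, so \<open>x = []\<close>, and the
  record is the leading 1 with one 0 for each tick satisfying \<open>\<beta>\<close>.\<close>

lemma unfolds_initial:
  assumes "\<not> det \<Longrightarrow> h = (\<lambda>x _. h' x)"
  shows "unfolds machine (leaf u h (ticks B u)) (initial machine u) (3 * ticks B u + length u + 5)
    (if det then h [] (True # replicate (cost \<beta> (ticks B u)) False)
     else guess_sum \<beta> h' 0 (payload u) (ticks B u) [])"
    (is "unfolds _ ?lf _ _ ?N")
proof -
  define T where "T = B * length u - length (payload u) mod B"
  define pre where "pre = take (length u - length (payload u)) u"
  have "payload u = drop (Suc (length (takeWhile id u))) u"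
    by (simp add: payload_def dropWhile_eq_drop drop_Suc tl_drop)
  \<comment> \<open>A suffix of \<open>u\<close> is determined by its length; this locates the cell
    where the ticks begin.\<close>
  then obtain k where "payload u = drop k u" by blast
  then have "payload u = drop (length u - length (payload u)) u"
    by (cases "k \<le> length u") auto
  then have u: "u = pre @ payload u"
    unfolding pre_def by (metis append_take_drop_id)
  have len: "int (length pre) = int (length u) - int (length (payload u))"
    using length_payload_le[of u] by (simp add: pre_def)
  have "length (payload u) mod B \<le> B * length u"
    using length_payload_le[of u] B_pos
    by (metis le_trans mod_less_eq_dividend mult_le_mono1 nat_mult_1 Suc_leI One_nat_def)
  then have T: "int T = int B * int (length u) - int ((0 + length (payload u)) mod B)"
    by (simp add: T_def of_nat_diff)
  have t: "ticks B u = length (payload u) + T" by (simp add: ticks_def T_def)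
  have "unfolds machine ?lf (guess_config first_tick (cells u) (int (length pre)) (written []) [True])
    (3 * ticks B u + 3) ?N"
  proof (cases det)
    case True
    have N: "pad_sum det \<beta> (h []) 0 (ticks B u) [True] = ?N"
      using True pad_sum_det[of \<beta> "h []" 0 "ticks B u" "[True]"] by (simp add: cost_def)
    have f: "first_tick = Tick Pad False (0 mod B)"
      unfolding first_tick_def using True by simp
    have "unfolds machine ?lf (guess_config (Tick Pad False (0 mod B)) (cells u) (int (length pre)) (written []) [True])
      (length (payload u) + T + ticks B u + 3) (pad_sum det \<beta> (h []) 0 (length (payload u) + T) [True])"
      using T u by (intro unfolds_pad_copy) auto
    then show ?thesis
      unfolding f N[symmetric] t[symmetric] by (rule unfolds_mono) simp
  next
    case False
    have N: "guess_sum \<beta> h' 0 (payload u) (ticks B u) [] = ?N" using False by simp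
    have f: "first_tick = Tick Decide False (0 mod B)"
      unfolding first_tick_def using False by simp
    have "unfolds machine ?lf (guess_config (Tick Decide False (0 mod B)) (cells u) (int (length pre)) (written []) [True])
      (2 * (length (payload u) + T) + ticks B u + 3) (guess_sum \<beta> h' 0 (payload u) (length (payload u) + T) [])"
      using T u by (intro unfolds_decide_copy[OF False assms[OF False]]) (auto simp: t)
    then show ?thesis
      unfolding f N[symmetric] t[symmetric] by (rule unfolds_mono) simp
  qed
  then have "unfolds machine ?lf (guess_config Skip (cells u) (int (length ([] :: bool list))) (written []) [True])
     (3 * ticks B u + 3 + length u + 1) ?N"
    unfolding len payload_def by - (rule unfolds_skip[of u "[]" u], simp_all only: append_Nil)
  then have "unfolds machine ?lf (guess_config Init (cells u) 0 (written []) [])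
     (Suc (3 * ticks B u + 3 + length u + 1)) ?N"
    by - (rule unfolds_guess_step[where q' = Skip and mv = Stay and xa = "(Blank, Stay)" and oo = "Some True"],
      simp_all add: instructions_single guess_states_def cells_in_symbols del: act.simps)
  then show ?thesis
    by (simp add: initial_machine eval_nat_numeral)
qed

end

section \<open>The simulation phase and membership in the counting classes\<close>

lemma poly_nat_mono: "x \<le> y \<Longrightarrow> poly p x \<le> poly p (y::nat)"
  by (induction p) (auto intro: add_mono mult_mono)

lemma accepting_paths_eq: "accepting_paths M x = paths M (\<lambda>q. q \<in> accepting M) (initial M x)"
  by (auto simp: accepting_paths_def paths_def halting_path_def)

lemma rejecting_paths_eq: "rejecting_paths M x = paths M (\<lambda>q. q \<notin> accepting M) (initial M x)"
  by (auto simp: rejecting_paths_def paths_def halting_path_def)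

lemma outputs_eq: "outputs M (initial M x) =
  {y. \<exists>\<tau>s c. halting_path M x \<tau>s c \<and> fst c \<in> accepting M \<and> has_output c y}"
  by (auto simp: outputs_def halting_path_def)

lemma computation_transitions: "computation M c \<tau>s c' \<Longrightarrow> set \<tau>s \<subseteq> transitions M"
proof (induction \<tau>s arbitrary: c)
  case (Cons \<tau> \<tau>s)
  then have "set \<tau>s \<subseteq> transitions M" "\<tau> \<in> transitions M" using Cons.IH[of "fire \<tau> c"] by simp_all
  then show ?case by simp
qed simp

lemma finite_paths:
  assumes "ntm M" "poly_time M"
  shows "finite (paths M P (initial M x))"
proof -
  obtain p where p: "\<And>x \<tau>s c. computation M (initial M x) \<tau>s c \<Longrightarrow> length \<tau>s \<le> poly p (length x)"
    using assms(2) unfolding poly_time_def by blast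
  have "paths M P (initial M x) \<subseteq> {\<tau>s. set \<tau>s \<subseteq> transitions M \<and> length \<tau>s \<le> poly p (length x)}"
    using p by (auto simp: paths_def dest: computation_transitions)
  moreover have "finite (transitions M)" using assms(1) by (simp add: ntm_def)
  ultimately show ?thesis
    using finite_lists_length_le finite_subset by blast
qed

lemma inj_lift_transition: "inj lift_transition"
  by (auto simp: inj_on_def)

text \<open>The numerator: the sum truncated at \<open>ticks B u\<close>, brought to the denominator
  \<open>2 ^ cost \<beta> (ticks B u)\<close>.\<close>

definition guess_function :: "(nat \<Rightarrow> bool) \<Rightarrow> nat \<Rightarrow> bool list set \<Rightarrow> bool list \<Rightarrow> int" where
  "guess_function \<beta> B A u = guess_sum \<beta> (\<lambda>x. of_bool (x \<in> A)) 0 (payload u) (ticks B u) []"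

context guesser
begin

definition embed :: "bool list \<Rightarrow> bool list \<Rightarrow> config \<Rightarrow> config" where
  "embed u z c = (to_nat (Simulate (fst c)), (cells u, - 1) # snd c @ [written z])"

lemma guess_config_embed:
  "guess_config (Simulate (start M)) (cells u) (- 1) (input_tape x) z = embed u z (initial M x)"
  by (simp add: guess_config_def embed_def initial_def)

lemma read_cells_left: "read (cells u, - 1) = Blank"
  by (simp add: read_def cells_outside)

lemma moves_embed:
  assumes "length (snd c) = ntapes M"
  shows "moves machine (embed u z c) = lift_transition ` moves M c" (is "?L = ?R")
proof
  have "enabled (embed u z c) (lift_transition \<tau>)" if "enabled c \<tau>" for \<tau>
    using that by (cases c; cases \<tau>) (auto simp: embed_def read_cells_left)
  then show "?R \<subseteq> ?L"
    by (auto simp: moves_def machine_def simp del: lift_transition.simps)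
  show "?L \<subseteq> ?R"
  proof
    fix \<tau> assume "\<tau> \<in> ?L"
    then have e: "enabled (embed u z c) \<tau>"
      and "\<tau> \<in> guess_transitions \<or> \<tau> \<in> lift_transition ` transitions M"
      by (auto simp: moves_def machine_def)
    moreover have "\<tau> \<notin> guess_transitions"
      using e by (auto simp: guess_transitions_def guess_states_def embed_def)
    ultimately obtain \<sigma> where "\<sigma> \<in> transitions M" "\<tau> = lift_transition \<sigma>" by blast
    moreover from this have "enabled c \<sigma>"
      using e by (cases c; cases \<sigma>) (auto simp: embed_def)
    ultimately show "\<tau> \<in> ?R" by (auto simp: moves_def)
  qed
qed

lemma fire_embed:
  assumes "\<tau> \<in> moves M c" "length (snd c) = ntapes M"
  shows "fire (lift_transition \<tau>) (embed u z c) = embed u z (fire \<tau> c)"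
    and "length (snd (fire \<tau> c)) = ntapes M"
proof -
  obtain q \<gamma> q' \<alpha> where \<tau>: "\<tau> = (q, \<gamma>, q', \<alpha>)" by (metis prod_cases4)
  then have l: "length \<alpha> = ntapes M"
    using assms(1) M_ntm by (auto simp: moves_def ntm_def)
  have a: "act (Blank, Stay) (cells u, - 1) = (cells u, - 1)"
    using cells_outside[of "- 1" u] by (auto simp: fun_eq_iff)
  show "fire (lift_transition \<tau>) (embed u z c) = embed u z (fire \<tau> c)"
    using assms(2) l by (cases c) (simp add: \<tau> embed_def a zip_append del: act.simps)
  show "length (snd (fire \<tau> c)) = ntapes M"
    using assms(2) l by (cases c) (simp add: \<tau>)
qed

text \<open>Both directions matter: a leaf must reproduce the path counts of \<open>M\<close>
  exactly, including, for GapP, its rejecting paths.\<close>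

lemma computation_embed:
  assumes "length (snd c) = ntapes M"
  shows "computation machine (embed u z c) \<tau>s c' \<longleftrightarrow>
    (\<exists>\<sigma>s c0. \<tau>s = map lift_transition \<sigma>s \<and> computation M c \<sigma>s c0 \<and> c' = embed u z c0 \<and>
      length (snd c0) = ntapes M)"
  using assms
proof (induction \<tau>s arbitrary: c)
  case Nil
  then show ?case by (simp only: computation.simps map_is_Nil_conv) (metis computation.simps(1) list.map_disc_iff)
next
  case (Cons \<tau> \<tau>s)
  have "computation machine (embed u z c) (\<tau> # \<tau>s) c' \<longleftrightarrow>
    (\<exists>\<sigma>\<in>moves M c. \<tau> = lift_transition \<sigma> \<and> computation machine (embed u z (fire \<sigma> c)) \<tau>s c')"
    using moves_embed[OF Cons.prems, of u z] fire_embed(1)[OF _ Cons.prems, of _ u z]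
    by (subst computation_cases_moves) auto
  also have "\<dots> \<longleftrightarrow> (\<exists>\<sigma>\<in>moves M c. \<tau> = lift_transition \<sigma> \<and>
    (\<exists>\<sigma>s c0. \<tau>s = map lift_transition \<sigma>s \<and> computation M (fire \<sigma> c) \<sigma>s c0 \<and> c' = embed u z c0 \<and>
      length (snd c0) = ntapes M))"
    by (intro bex_cong refl conj_cong Cons.IH fire_embed(2)[OF _ Cons.prems])
  also have "\<dots> \<longleftrightarrow> (\<exists>\<sigma>s c0. \<tau> # \<tau>s = map lift_transition \<sigma>s \<and> computation M c \<sigma>s c0 \<and> c' = embed u z c0 \<and>
      length (snd c0) = ntapes M)"
    (is "?L \<longleftrightarrow> ?R")
  proof
    assume ?L
    then obtain \<sigma> \<sigma>s c0 where "\<sigma> \<in> moves M c" "\<tau> # \<tau>s = map lift_transition (\<sigma> # \<sigma>s)"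
      "computation M (fire \<sigma> c) \<sigma>s c0" "c' = embed u z c0" "length (snd c0) = ntapes M"
      unfolding list.map by blast
    moreover from this have "computation M c (\<sigma> # \<sigma>s) c0" by (simp add: moves_def)
    ultimately show ?R by (intro exI[of _ "\<sigma> # \<sigma>s"] exI[of _ c0] conjI)
  next
    assume ?R
    then obtain \<sigma> \<sigma>s c0 where "\<tau> = lift_transition \<sigma>" "\<tau>s = map lift_transition \<sigma>s"
      "computation M c (\<sigma> # \<sigma>s) c0" "c' = embed u z c0" "length (snd c0) = ntapes M"
      unfolding Cons_eq_map_conv by blast
    moreover from this have "\<sigma> \<in> moves M c" "computation M (fire \<sigma> c) \<sigma>s c0" by (simp_all add: moves_def)
    ultimately show ?L by (intro bexI[of _ \<sigma>] exI[of _ \<sigma>s] exI[of _ c0] conjI)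
  qed
  finally show ?case .
qed

lemma halted_embed: "length (snd c) = ntapes M \<Longrightarrow> halted machine (embed u z c) \<longleftrightarrow> halted M c"
  by (simp add: halted_iff_moves moves_embed)

lemma length_initial: "length (snd (initial M x)) = ntapes M"
  using M_ntapes_pos by (simp add: initial_def)

lemma computation_length:
  "computation M c \<sigma>s c0 \<Longrightarrow> length (snd c) = ntapes M \<Longrightarrow> length (snd c0) = ntapes M"
proof (induction \<sigma>s arbitrary: c)
  case (Cons \<sigma> \<sigma>s)
  then have "\<sigma> \<in> moves M c" by (simp add: moves_def)
  then show ?case using Cons.IH[of "fire \<sigma> c"] Cons.prems fire_embed(2) by simp
qed simp

lemma computation_embed_initial:
  "computation machine (embed u z (initial M x)) \<tau>s c' \<and> halted machine c' \<longleftrightarrow>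
    (\<exists>\<sigma>s c0. \<tau>s = map lift_transition \<sigma>s \<and> c' = embed u z c0 \<and>
      computation M (initial M x) \<sigma>s c0 \<and> halted M c0)"
  (is "?L \<longleftrightarrow> ?R")
proof
  assume ?L
  then obtain \<sigma>s c0 where "\<tau>s = map lift_transition \<sigma>s" "computation M (initial M x) \<sigma>s c0"
    "c' = embed u z c0" "length (snd c0) = ntapes M" "halted machine c'"
    unfolding computation_embed[OF length_initial] by blast
  then show ?R using halted_embed by blast
next
  assume ?R
  then obtain \<sigma>s c0 where "\<tau>s = map lift_transition \<sigma>s" "c' = embed u z c0"
    and c: "computation M (initial M x) \<sigma>s c0" "halted M c0"
    by blast
  then show ?L
    using computation_length[OF c(1) length_initial] halted_embed
    unfolding computation_embed[OF length_initial] by blast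
qed

lemma paths_embed:
  "paths machine P (embed u z (initial M x)) =
    map lift_transition ` paths M (\<lambda>q. P (to_nat (Simulate q))) (initial M x)"
proof -
  have f: "fst (embed u z c) = to_nat (Simulate (fst c))" for c by (simp add: embed_def)
  have "\<tau>s \<in> paths machine P (embed u z (initial M x)) \<longleftrightarrow>
    (\<exists>\<sigma>s c0. \<tau>s = map lift_transition \<sigma>s \<and> computation M (initial M x) \<sigma>s c0 \<and> halted M c0 \<and>
      P (to_nat (Simulate (fst c0))))" for \<tau>s
    unfolding paths_def mem_Collect_eq conj_assoc[symmetric] computation_embed_initial f[symmetric]
    by metis
  then show ?thesis
    unfolding paths_def by blast
qed

lemma card_paths_embed:
  assumes "poly_time M"
  shows "finite (paths machine P (embed u z (initial M x)))"
    and "card (paths machine P (embed u z (initial M x))) =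
      card (paths M (\<lambda>q. P (to_nat (Simulate q))) (initial M x))"
  using finite_paths[OF M_ntm assms] inj_lift_transition
  by (simp_all add: paths_embed card_image inj_mapI inj_on_subset[OF inj_mapI subset_UNIV])

lemma accepting_machine: "to_nat (Simulate q) \<in> accepting machine \<longleftrightarrow> q \<in> accepting M"
  by (auto simp: machine_def)

text \<open>\<open>M\<close> leaves the record untouched, so all its accepting paths yield the same
  output \<open>z\<close>. Their number, which is arbitrary for an NP machine, disappears and only
  acceptance of \<open>x\<close> remains.\<close>

lemma outputs_embed:
  "outputs machine (embed u z (initial M x)) = (if accepting_paths M x = {} then {} else {z})"
proof -
  have o: "has_output (embed u z c) y \<longleftrightarrow> y = z" for c y
    by (rule has_output_written) (simp add: embed_def)
  have f: "fst (embed u z c) \<in> accepting machine \<longleftrightarrow> fst c \<in> accepting M" for c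
    by (simp add: embed_def accepting_machine)
  have "accepting_paths M x \<noteq> {} \<longleftrightarrow>
    (\<exists>\<sigma>s c. computation M (initial M x) \<sigma>s c \<and> halted M c \<and> fst c \<in> accepting M)"
    unfolding accepting_paths_eq paths_def by blast
  moreover have "y \<in> outputs machine (embed u z (initial M x)) \<longleftrightarrow> y = z \<and>
    (\<exists>\<sigma>s c. computation M (initial M x) \<sigma>s c \<and> halted M c \<and> fst c \<in> accepting M)" for y
    unfolding outputs_def mem_Collect_eq conj_assoc[symmetric] computation_embed_initial
    using o f by (metis (no_types, lifting))
  ultimately have "y \<in> outputs machine (embed u z (initial M x)) \<longleftrightarrow> y = z \<and> accepting_paths M x \<noteq> {}" for y
    by (simp only:)
  then show ?thesis by auto
qed

lemma machine_poly_time: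
  assumes "poly_time M"
  shows "poly_time machine"
proof -
  obtain p where p: "\<And>x \<tau>s c. computation M (initial M x) \<tau>s c \<Longrightarrow> length \<tau>s \<le> poly p (length x)"
    using assms unfolding poly_time_def by blast
  define r where "r = pcompose p [:0, B + 1:] + [:5, 3 * (B + 1) + 1:]"
  have "length \<tau>s \<le> poly r (length u)" if "computation machine (initial machine u) \<tau>s c" for u \<tau>s c
  proof -
    \<comment> \<open>Only the running time is wanted here, so all leaf values are set to 0.\<close>
    have "length \<tau>s \<le> poly p (ticks B u)"
      if l: "leaf u (\<lambda>_ _. 0) (ticks B u) c N" "computation machine c \<tau>s c'" for c N \<tau>s c'
    proof -
      obtain x z where x: "length x \<le> ticks B u" "c = embed u z (initial M x)"
        using l(1) unfolding leaf_def guess_config_embed by blast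
      then have "length \<tau>s \<le> poly p (length x)"
        using l(2) p unfolding x(2) computation_embed[OF length_initial] by (metis length_map)
      then show ?thesis using x(1) poly_nat_mono le_trans by blast
    qed
    then have "length \<tau>s \<le> poly p (ticks B u) + (3 * ticks B u + length u + 5)"
      using that by (intro unfolds_time[OF unfolds_initial[where h = "\<lambda>_ _. 0" and h' = "\<lambda>_. 0"]]) auto
    also have "\<dots> \<le> poly p ((B + 1) * length u) + (3 * ((B + 1) * length u) + length u + 5)"
      using ticks_bounds(2)[of B u] by (intro add_mono poly_nat_mono mult_left_mono) auto
    also have "\<dots> = poly r (length u)"
      by (simp add: r_def poly_pcompose algebra_simps)
    finally show ?thesis .
  qed
  then show ?thesis unfolding poly_time_def by blast
qed

lemma unfolds_guess_function:
  assumes "\<not> det"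
  shows "unfolds machine (leaf u (\<lambda>x _. of_bool (x \<in> A)) (ticks B u)) (initial machine u)
    (3 * ticks B u + length u + 5) (guess_function \<beta> B A u)"
proof -
  have "guess_function \<beta> B A u =
    (if det then of_bool ([] \<in> A) else guess_sum \<beta> (\<lambda>x. of_bool (x \<in> A)) 0 (payload u) (ticks B u) [])"
    unfolding guess_function_def if_not_P[OF assms] ..
  then show ?thesis
    using unfolds_initial[where h = "\<lambda>x _. of_bool (x \<in> A)" and h' = "\<lambda>x. of_bool (x \<in> A)", OF refl]
    by (simp only:)
qed

lemma guess_function_GapP:
  assumes "\<not> det" "poly_time M"
    and "\<And>x. int (card (accepting_paths M x)) - int (card (rejecting_paths M x)) = of_bool (x \<in> A)"
  shows "guess_function \<beta> B A \<in> GapP"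
proof -
  have "int (card (accepting_paths machine u)) - int (card (rejecting_paths machine u)) = guess_function \<beta> B A u" for u
    unfolding accepting_paths_eq rejecting_paths_eq
    using assms(3) card_paths_embed[OF assms(2)]
    by (intro unfolds_gap[OF unfolds_guess_function[OF assms(1)], THEN conjunct2, THEN conjunct2])
      (auto simp: leaf_def guess_config_embed accepting_machine accepting_paths_eq rejecting_paths_eq)
  then show ?thesis
    using machine_ntm machine_poly_time[OF assms(2)] unfolding GapP_def
    by (intro CollectI exI[of _ machine]) simp
qed

lemma guess_function_SharpP:
  assumes "\<not> det" "poly_time M"
    and "\<And>x. int (card (accepting_paths M x)) = of_bool (x \<in> A)"
  shows "guess_function \<beta> B A \<in> SharpP"
proof -
  have e: "paths K (\<lambda>_. False) c = {}" for K c by (simp add: paths_def)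
  have "int (card (paths machine (\<lambda>q. q \<in> accepting machine) (initial machine u))) -
      int (card (paths machine (\<lambda>_. False) (initial machine u))) = guess_function \<beta> B A u" for u
    using assms(3) card_paths_embed[OF assms(2)]
    by (intro unfolds_gap[OF unfolds_guess_function[OF assms(1)], THEN conjunct2, THEN conjunct2])
      (auto simp: leaf_def guess_config_embed accepting_machine accepting_paths_eq e)
  then show ?thesis
    using machine_ntm machine_poly_time[OF assms(2)] unfolding SharpP_def accepting_paths_eq
    by (intro CollectI exI[of _ machine]) (simp add: e)
qed

lemma guess_function_SpanP:
  assumes "\<not> det" "poly_time M" "A = {x. accepting_paths M x \<noteq> {}}"
  shows "guess_function \<beta> B A \<in> SpanP"
proof -
  have "int (card (outputs machine (initial machine u))) = guess_function \<beta> B A u" for u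
  proof (rule unfolds_span[OF unfolds_guess_function[OF assms(1)] machine_append_only, THEN conjunct2])
    show "\<exists>z. last (snd (initial machine u)) = written z"
      by (auto simp: initial_machine guess_config_def)
  qed (auto simp: leaf_def guess_config_embed outputs_embed assms(3))
  then show ?thesis
    using machine_ntm machine_poly_time[OF assms(2)] unfolding SpanP_def outputs_eq
    by (intro CollectI exI[of _ machine]) simp
qed

end

section \<open>The denominator and the constant function 1\<close>

lemma binary_value_power: "binary_value (True # replicate n False) = 2 ^ n"
  by (induction n) (auto simp: binary_value_def horner_sum_append replicate_append_same)

definition idle_machine :: ntm where
  "idle_machine = \<lparr>ntapes = 1, start = 0, accepting = {0}, transitions = {}\<rparr>"

lemma computation_idle: "computation idle_machine c \<tau>s c' \<longleftrightarrow> \<tau>s = [] \<and> c' = c"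
  by (cases \<tau>s) (auto simp: idle_machine_def)

lemma halted_idle: "halted idle_machine c"
  by (simp add: halted_def idle_machine_def)

lemma idle_machine_ntm: "ntm idle_machine"
  by (simp add: ntm_def idle_machine_def)

lemma idle_machine_poly_time: "poly_time idle_machine"
  unfolding poly_time_def by (simp add: computation_idle)

text \<open>The deterministic variant, combined with a machine that halts at once, prints this power
  in binary. Running through the same ticks, it refers to the same truncation point as the
  numerator.\<close>

lemma power_cost_poly_time_computable:
  assumes "0 < B" "\<And>i. \<beta> (i mod B) = \<beta> i"
  shows "poly_time_computable (\<lambda>u. 2 ^ cost \<beta> (ticks B u))"
proof -
  interpret guesser True \<beta> B idle_machine
    using assms idle_machine_ntm by unfold_locales
  define h :: "bool list \<Rightarrow> bool list \<Rightarrow> int" where "h = (\<lambda>_ z. int (binary_value z))"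
  have d: "deterministic machine"
    by (rule machine_deterministic) (simp_all add: idle_machine_def)
  have "\<exists>\<tau>s c' y. computation machine (initial machine u) \<tau>s c' \<and> halted machine c' \<and> has_output c' y \<and>
      int (2 ^ cost \<beta> (ticks B u)) = int (binary_value y)" for u
  proof (rule unfolds_deterministic_output[OF _ d])
    show "unfolds machine (leaf u h (ticks B u)) (initial machine u) (3 * ticks B u + length u + 5)
      (int (2 ^ cost \<beta> (ticks B u)))"
      using unfolds_initial[of h undefined u] by (simp add: h_def binary_value_power)
    fix c N assume "leaf u h (ticks B u) c N"
    then obtain x z where c: "c = embed u z (initial idle_machine x)" and N: "N = int (binary_value z)"
      by (auto simp: leaf_def h_def guess_config_embed)
    have "halted machine c" unfolding c by (simp add: halted_embed length_initial halted_idle)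
    moreover have "has_output c z" using has_output_written[of c z z] by (simp add: c embed_def)
    moreover have "computation machine c [] c" by simp
    ultimately show "\<exists>\<tau>s c' y. computation machine c \<tau>s c' \<and> halted machine c' \<and> has_output c' y \<and>
      N = int (binary_value y)" using N by blast
  qed
  then show ?thesis
    unfolding poly_time_computable_def halting_path_def of_nat_eq_iff
    using machine_ntm d machine_poly_time[OF idle_machine_poly_time] by blast
qed

text \<open>The idle machine has just the empty path, which accepts; its only tape displays the
  input as the one output.\<close>

lemma one_in_counting_classes:
  "(\<lambda>_. 1) \<in> SharpP" "(\<lambda>_. 1) \<in> SpanP" "(\<lambda>_. 1) \<in> GapP"
proof -
  have i: "fst (initial idle_machine x) \<in> accepting idle_machine" for x
    by (simp add: initial_def idle_machine_def)
  have a: "accepting_paths idle_machine x = {[]}" for x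
    unfolding accepting_paths_def halting_path_def computation_idle using halted_idle i by auto
  have r: "rejecting_paths idle_machine x = {}" for x
    unfolding rejecting_paths_def halting_path_def computation_idle using i by auto
  have o: "{y. \<exists>\<tau>s c. halting_path idle_machine x \<tau>s c \<and> fst c \<in> accepting idle_machine \<and> has_output c y} = {x}" for x
  proof -
    have "has_output (initial idle_machine x) y \<longleftrightarrow> has_output (0, [written x]) y" for y
      by (simp add: has_output_def initial_def idle_machine_def written_def)
    moreover have "has_output (0, [written x]) y \<longleftrightarrow> y = x" for y
      by (rule has_output_written) simp
    ultimately show ?thesis
      unfolding halting_path_def computation_idle using halted_idle i by auto
  qed
  note idle = idle_machine_ntm idle_machine_poly_time
  show "(\<lambda>_. 1) \<in> SharpP" unfolding SharpP_def using idle by (auto simp: a intro!: exI[of _ idle_machine])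
  show "(\<lambda>_. 1) \<in> SpanP" unfolding SpanP_def using idle
    by (intro CollectI exI[of _ idle_machine]) (simp add: o del: split_paired_Ex)
  show "(\<lambda>_. 1) \<in> GapP" unfolding GapP_def using idle by (auto simp: a r intro!: exI[of _ idle_machine])
qed

section \<open>The martingale\<close>

text \<open>If \<open>n\<close> exceeds the length of \<open>v\<close>, the extensions of
  \<open>v\<close> split according to their next bit and the power of 2 doubles. Otherwise the
  appended bit is never inspected.\<close>

lemma extension_sum_martingale:
  "extension_sum h n (v @ [False]) x + extension_sum h n (v @ [True]) x = 2 * extension_sum h n v x"
proof (induction n arbitrary: v x)
  case (Suc n)
  show ?case
  proof (cases v)
    case (Cons b v')
    then show ?thesis using Suc[of v' "x @ [b]"] by simp
  qed simp
qed simp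

lemma extension_sum_nonneg: "(\<And>x. 0 \<le> h x) \<Longrightarrow> 0 \<le> extension_sum h n v x"
  by (induction h n v x rule: extension_sum.induct) auto

lemma extension_sum_full: "extension_sum h (length v) v x = 2 ^ length v * h (x @ v)"
  by (induction v arbitrary: x) auto

text \<open>A nonnegative martingale at most doubles with each bit.\<close>

lemma extension_sum_le:
  assumes "\<And>x. 0 \<le> h x"
  shows "extension_sum h n w x \<le> 2 ^ length w * extension_sum h n [] x"
proof (induction w rule: rev_induct)
  case (snoc b w)
  have "extension_sum h n (w @ [b]) x \<le> 2 * extension_sum h n w x"
    using extension_sum_martingale[of h n w x] extension_sum_nonneg[of h, OF assms, of n "w @ [\<not> b]" x]
    by (cases b) auto
  then show ?case using snoc by simp
qed simp

lemma finite_lists_length: "finite {y :: bool list. length y = n \<and> P y}"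
  by (rule finite_subset[OF _ finite_lists_length_eq[of "UNIV :: bool set" n]]) auto

lemma extension_sum_Nil:
  "extension_sum (\<lambda>x. of_bool (x \<in> A)) n [] x = int (card {y. length y = n \<and> x @ y \<in> A})"
proof (induction n arbitrary: x)
  case 0
  have "{y. length y = 0 \<and> x @ y \<in> A} = (if x \<in> A then {[]} else {})" by auto
  then show ?case by simp
next
  case (Suc n)
  let ?S = "\<lambda>b. {y. length y = n \<and> (x @ [b]) @ y \<in> A}"
  have "{y. length y = Suc n \<and> x @ y \<in> A} = (#) False ` ?S False \<union> (#) True ` ?S True" (is "?L = ?R")
  proof
    show "?L \<subseteq> ?R"
    proof
      fix y assume "y \<in> ?L"
      then obtain b y' where "y = b # y'" "y' \<in> ?S b" by (cases y) auto
      then show "y \<in> ?R" by (cases b) auto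
    qed
  qed auto
  moreover have "card ((#) False ` ?S False \<union> (#) True ` ?S True) = card (?S False) + card (?S True)"
    by (subst card_Un_disjoint) (auto simp: card_image finite_lists_length)
  ultimately show ?case using Suc[of "x @ [False]"] Suc[of "x @ [True]"] by simp
qed

lemma extension_sum_slice: "extension_sum (\<lambda>x. of_bool (x \<in> A)) n [] [] = int (card (slice A n))"
  by (simp add: extension_sum_Nil slice_def conj_commute)

text \<open>Periodic with period \<open>b\<close>, and exactly \<open>\<lfloor>a n / b\<rfloor>\<close> of the ticks below \<open>n\<close> satisfy it.\<close>
definition rate :: "nat \<Rightarrow> nat \<Rightarrow> nat \<Rightarrow> bool" where
  "rate a b i \<longleftrightarrow> Suc i * a div b \<noteq> i * a div b"

text \<open>As \<open>a \<le> b\<close>, the floor rises by 0 or 1 at each tick, and the rises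
  telescope.\<close>

lemma cost_rate:
  assumes "a \<le> b" "0 < b"
  shows "cost (rate a b) n = n * a div b"
proof (induction n)
  case 0
  then show ?case by (simp add: cost_def)
next
  case (Suc n)
  have "n * a div b \<le> Suc n * a div b" by (intro div_le_mono) simp
  moreover have "Suc n * a div b \<le> (n * a + b) div b" using assms(1) by (intro div_le_mono) simp
  moreover have "(n * a + b) div b = n * a div b + 1" using assms(2) by simp
  ultimately show ?case using Suc by (auto simp: rate_def)
qed

text \<open>Raising \<open>i\<close> by \<open>b * k\<close> raises the floor by exactly
  \<open>a * k\<close>, so the rises repeat. The multiple \<open>m\<close> leaves room to enlarge
  the number of ticks per cell.\<close>

lemma rate_periodic:
  assumes "0 < b"
  shows "rate a b (i mod (b * m)) = rate a b i"
proof -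
  have *: "(j + b * k) * a div b = j * a div b + k * a" for j k
  proof -
    have "(j + b * k) * a = j * a + b * (k * a)" by (simp add: algebra_simps)
    then show ?thesis using assms by (simp only: div_mult_self2 add.commute)
  qed
  have i: "i = i mod (b * m) + b * (m * (i div (b * m)))"
    using mod_mult_div_eq[of i "b * m"] by (simp add: mult.assoc)
  let ?j = "i mod (b * m)" and ?k = "m * (i div (b * m))"
  have "rate a b i = rate a b (?j + b * ?k)" using i by simp
  also have "\<dots> = rate a b ?j"
    using *[of ?j ?k] *[of "Suc ?j" ?k] unfolding rate_def by simp
  finally show ?thesis by simp
qed

section \<open>Growth of slices and convergence of the martingale\<close>

lemma entropy_rate_nonneg: "0 \<le> entropy_rate A"
proof -
  have "0 \<le> log 2 (real (card (slice A n))) / real n" for n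
    by (cases "card (slice A n) = 0") (auto simp: log_def)
  then have "limsup (\<lambda>n. 0 :: ereal) \<le> entropy_rate A"
    unfolding entropy_rate_def by (intro Limsup_mono) (simp add: zero_ereal_def)
  then show ?thesis by (simp add: Limsup_const)
qed

text \<open>The limit superior controls all but finitely many lengths. \<open>C\<close> absorbs the
  others, since \<open>s > 0\<close> keeps the exponential at least 1.\<close>

lemma card_slice_bound:
  assumes "entropy_rate A < ereal s"
  shows "\<exists>C>0. \<forall>n. real (card (slice A n)) \<le> C * 2 powr (s * real n)"
proof -
  have s: "0 < s" using entropy_rate_nonneg[of A] assms by (metis ereal_less(2) order.strict_trans1)
  have "\<forall>\<^sub>F n in sequentially. ereal (log 2 (real (card (slice A n))) / real n) < ereal s"
    using assms unfolding entropy_rate_def by (rule Limsup_lessD)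
  then obtain k where k: "\<And>n. n \<ge> k \<Longrightarrow> log 2 (real (card (slice A n))) / real n < s"
    by (auto simp: eventually_sequentially)
  define C where "C = 1 + (\<Sum>n\<le>k. real (card (slice A n)))"
  have C: "1 \<le> C" by (simp add: C_def sum_nonneg)
  have "real (card (slice A n)) \<le> C * 2 powr (s * real n)" for n
  proof (cases "n \<le> k")
    case True
    have "real (card (slice A n)) \<le> (\<Sum>n\<le>k. real (card (slice A n)))"
      using True by (intro member_le_sum) auto
    then have "real (card (slice A n)) * 1 \<le> C * 2 powr (s * real n)"
      using s C by (intro mult_mono ge_one_powr_ge_zero) (auto simp: C_def)
    then show ?thesis by simp
  next
    case False
    have "real (card (slice A n)) \<le> 2 powr (s * real n)"
    proof (cases "card (slice A n) = 0")
      case card: False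
      have "log 2 (real (card (slice A n))) < s * real n"
        using k[of n] False by (simp add: divide_simps)
      then show ?thesis using card by (simp add: log_less_iff)
    qed simp
    also have "\<dots> \<le> C * 2 powr (s * real n)" using C by simp
    finally show ?thesis .
  qed
  then show ?thesis using C by (intro exI[of _ C]) auto
qed

lemma payload_encode_pair: "payload (encode_pair w r) = w"
  by (induction r) (simp_all add: payload_def encode_pair_def)

lemma summable_tail_bound:
  fixes t :: "nat \<Rightarrow> real"
  assumes t: "\<And>n. 0 \<le> t n" "\<And>n. t n \<le> K * \<rho> ^ n" and \<rho>: "0 \<le> \<rho>" "\<rho> < 1"
  shows "summable t" "0 \<le> suminf t - (\<Sum>n\<le>L. t n)" "suminf t - (\<Sum>n\<le>L. t n) \<le> K * \<rho> ^ L / (1 - \<rho>)"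
proof -
  have K: "0 \<le> K" using t(1)[of 0] t(2)[of 0] by simp
  have g: "summable (\<lambda>n. K * \<rho> ^ n)" using \<rho> by (intro summable_mult summable_geometric) auto
  show s: "summable t"
    using t by (intro summable_comparison_test'[OF g, of 0]) auto
  have e: "suminf t - (\<Sum>n\<le>L. t n) = (\<Sum>n. t (n + Suc L))"
    using suminf_minus_initial_segment[OF s, of "Suc L"] by (simp add: lessThan_Suc_atMost)
  have s': "summable (\<lambda>n. t (n + Suc L))" using s summable_ignore_initial_segment by blast
  show "0 \<le> suminf t - (\<Sum>n\<le>L. t n)" unfolding e using t(1) s' by (intro suminf_nonneg)
  have "t (n + Suc L) \<le> K * \<rho> ^ L * \<rho> ^ n" for n
  proof -
    \<comment> \<open>A factor \<open>\<rho>\<close> is given away to obtain the simpler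
      \<open>\<rho> ^ L\<close>.\<close>
    have "\<rho> ^ (n + Suc L) \<le> \<rho> ^ (n + L)" using \<rho> by (intro power_decreasing) auto
    then have "K * \<rho> ^ (n + Suc L) \<le> K * \<rho> ^ (n + L)" using K by (intro mult_left_mono)
    then show ?thesis using t(2)[of "n + Suc L"] by (simp add: power_add mult_ac)
  qed
  then have "(\<Sum>n. t (n + Suc L)) \<le> (\<Sum>n. K * \<rho> ^ L * \<rho> ^ n)"
    using \<rho> by (intro suminf_le s' summable_mult summable_geometric) auto
  also have "\<dots> = K * \<rho> ^ L / (1 - \<rho>)"
    using \<rho> by (simp add: suminf_mult summable_geometric suminf_geometric)
  finally show "suminf t - (\<Sum>n\<le>L. t n) \<le> K * \<rho> ^ L / (1 - \<rho>)" unfolding e .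
qed

text \<open>The first assumption quantifies over \<open>\<beta>\<close> and \<open>B\<close> because
  they depend on the rational rate and on constants fixed only inside the proof.\<close>

lemma class_martingale_of_language:
  assumes A: "\<And>\<beta> B. 0 < B \<Longrightarrow> (\<And>i. \<beta> (i mod B) = \<beta> i) \<Longrightarrow> guess_function \<beta> B A \<in> \<Delta>"
    and s: "entropy_rate A < ereal s" "s \<le> 1"
  shows "\<exists>d. class_martingale \<Delta> d \<and> (\<forall>w\<in>A. 2 powr ((1 - s) * real (length w)) \<le> d w)"
proof -
  \<comment> \<open>\<open>s1\<close> bounds the growth of the slices and \<open>q = a / b\<close>
    is the rate of the denominators: \<open>s1 < q\<close> gives convergence, \<open>q < s\<close>
    gives success.\<close>
  obtain s1 where s1: "entropy_rate A < ereal s1" "s1 < s"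
    using ereal_dense2[OF s(1)] by auto
  have "0 < s1" using entropy_rate_nonneg[of A] s1(1) by (metis ereal_less(2) order.strict_trans1)
  obtain q where q: "q \<in> \<rat>" "s1 < q" "q < s" using Rats_dense_in_real[OF s1(2)] by blast
  then obtain a b :: nat where ab: "b \<noteq> 0" "q = real a / real b"
    using Rats_abs_nat_div_natE[OF q(1)] \<open>0 < s1\<close> by (metis abs_of_pos order.strict_trans)
  have b: "0 < b" using ab by simp
  have "real a / real b < 1" using ab(2) q(3) s(2) by linarith
  then have a_le: "a \<le> b" using b by simp
  obtain C where C: "0 < C" "\<And>n. real (card (slice A n)) \<le> C * 2 powr (s1 * real n)"
    using card_slice_bound[OF s1(1)] by blast
  define \<rho> where "\<rho> = 2 powr (s1 - q)"
  have \<rho>: "0 < \<rho>" "\<rho> < 1" using q(2) by (auto simp: \<rho>_def powr_less_one)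
  have \<rho>_pow: "\<rho> ^ n = 2 powr ((s1 - q) * real n)" for n
    by (simp add: \<rho>_def powr_powr flip: powr_realpow)
  define h where "h = (\<lambda>x. of_bool (x \<in> A) :: int)"
  have h: "0 \<le> h x" for x by (simp add: h_def)
  define c where "c = cost (rate a b)"
  have c: "c n = n * a div b" for n unfolding c_def by (rule cost_rate[OF a_le b])
  have c_le: "real (c n) \<le> q * real n" for n
    using of_nat_div_le_of_nat[of "n * a" b, where ?'a = real] by (simp add: c ab mult.commute)
  have c_ge: "q * real n - 1 \<le> real (c n)" for n
  proof -
    have "real (n * a mod b) / real b \<le> 1" using b by (simp add: less_imp_le)
    then show ?thesis
      using of_nat_of_nat_div_aux[of "n * a" b, where ?'a = real] by (simp add: c ab mult.commute)
  qed
  define t where "t w n = real_of_int (extension_sum h n w []) / 2 ^ c n" for w n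
  have t_nonneg: "0 \<le> t w n" for w n
    using extension_sum_nonneg[of h, OF h] by (simp add: t_def)
  \<comment> \<open>The factor 2 pays for the floor in \<open>c n\<close>.\<close>
  have t_le: "t w n \<le> (2 * C * 2 ^ length w) * \<rho> ^ n" for w n
  proof -
    have "real_of_int (extension_sum h n w []) \<le> real_of_int (2 ^ length w * int (card (slice A n)))"
      using extension_sum_le[of h n w "[]", OF h] by (simp only: of_int_le_iff h_def extension_sum_slice)
    also have "\<dots> \<le> 2 ^ length w * (C * 2 powr (s1 * real n))" using C(2) by simp
    finally have 1: "real_of_int (extension_sum h n w []) \<le> 2 ^ length w * (C * 2 powr (s1 * real n))" .
    have "2 powr (q * real n - 1) \<le> 2 powr real (c n)" using c_ge by (intro powr_mono) auto
    then have 2: "2 powr (q * real n - 1) \<le> 2 ^ c n" by (simp add: powr_realpow)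
    have "t w n \<le> 2 ^ length w * (C * 2 powr (s1 * real n)) / 2 powr (q * real n - 1)"
      unfolding t_def using 1 2 C(1) extension_sum_nonneg[of h, OF h] by (intro frac_le) auto
    also have "\<dots> = (2 * C * 2 ^ length w) * 2 powr (s1 * real n - q * real n)"
      by (simp add: powr_diff)
    also have "\<dots> = (2 * C * 2 ^ length w) * \<rho> ^ n" by (simp add: \<rho>_pow algebra_simps)
    finally show ?thesis .
  qed
  note tail = summable_tail_bound[OF t_nonneg t_le less_imp_le[OF \<rho>(1)] \<rho>(2)]
  define d where "d w = (\<Sum>n. t w n)" for w
  have "martingale d"
    unfolding martingale_def
  proof (intro conjI allI)
    fix w
    show "0 \<le> d w" unfolding d_def using t_nonneg tail(1) by (intro suminf_nonneg)
    have "t (w @ [False]) n + t (w @ [True]) n = 2 * t w n" for n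
    proof -
      have "real_of_int (extension_sum h n (w @ [False]) []) + real_of_int (extension_sum h n (w @ [True]) []) =
        2 * real_of_int (extension_sum h n w [])"
        using extension_sum_martingale[of h n w "[]"] by linarith
      then show ?thesis by (simp add: t_def add_divide_distrib[symmetric])
    qed
    then have "d (w @ [False]) + d (w @ [True]) = 2 * d w"
      unfolding d_def using tail(1) by (simp add: suminf_add suminf_mult)
    then show "d w = (d (w @ [False]) + d (w @ [True])) / 2" by simp
  qed
  have "(\<lambda>m. \<rho> ^ m) \<longlonglongrightarrow> 0" using \<rho> by (intro LIMSEQ_power_zero) auto
  moreover have "0 < min (1 / 2) ((1 - \<rho>) / (2 * C))" using \<rho> C by simp
  ultimately have "\<forall>\<^sub>F m in sequentially. \<rho> ^ m < min (1 / 2) ((1 - \<rho>) / (2 * C))"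
    by (rule order_tendstoD(2))
  \<comment> \<open>One factor \<open>\<rho> ^ m\<close> will cancel
    \<open>2 * C / (1 - \<rho>)\<close>, and each further one halves the error. The maximum with 1
    keeps \<open>m\<close> positive.\<close>
  then obtain m0 where "\<rho> ^ max m0 1 < min (1 / 2) ((1 - \<rho>) / (2 * C))"
    unfolding eventually_sequentially using max.cobounded1 by blast
  then obtain m where m: "0 < m" "\<rho> ^ m \<le> 1 / 2" "\<rho> ^ m \<le> (1 - \<rho>) / (2 * C)"
    by (metis less_imp_le max.strict_coboundedI2 min_less_iff_conj zero_less_one)
  define B where "B = b * m"
  have B: "0 < B" using b m by (simp add: B_def)
  have per: "rate a b (i mod B) = rate a b i" for i
    unfolding B_def by (rule rate_periodic[OF b])
  define f where "f = guess_function (rate a b) B A"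
  define g where "g u = (2 :: nat) ^ cost (rate a b) (ticks B u)" for u
  have f: "f \<in> \<Delta>" unfolding f_def using A[where \<beta> = "rate a b", OF B per] .
  have g: "poly_time_computable g" unfolding g_def using power_cost_poly_time_computable[where \<beta> = "rate a b", OF B per] .
  have approx: "\<bar>d w - real_of_int (f (encode_pair w r)) / real (g (encode_pair w r))\<bar> \<le> 2 powr (- real r)" for w r
  proof -
    define L where "L = ticks B (encode_pair w r)"
    have fg: "real_of_int (f (encode_pair w r)) / real (g (encode_pair w r)) = (\<Sum>n\<le>L. t w n)"
    proof -
      have "f (encode_pair w r) = (\<Sum>n\<le>L. 2 ^ (c L - c n) * extension_sum h n w [])"
        by (simp add: f_def guess_function_def guess_sum_def payload_encode_pair L_def c_def h_def)
      moreover have "real (g (encode_pair w r)) = 2 ^ c L" by (simp add: g_def L_def c_def)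
      moreover have "real_of_int (2 ^ (c L - c n) * extension_sum h n w []) / 2 ^ c L = t w n" if "n \<le> L" for n
      proof -
        have "c n \<le> c L" unfolding c_def using that by (rule cost_mono)
        then have "(2::real) ^ c L = 2 ^ (c L - c n) * 2 ^ c n" by (simp flip: power_add)
        then show ?thesis by (simp add: t_def)
      qed
      ultimately show ?thesis by (simp add: sum_divide_distrib)
    qed
    have "B * length (encode_pair w r) \<le> L" unfolding L_def by (rule ticks_bounds(1))
    \<comment> \<open>The separating 0 of the encoding supplies the \<open>+ 1\<close>, that is, the
      factor that cancels the constant. The other \<open>r + length w\<close> halvings yield
      \<open>2 powr (- r)\<close> and compensate \<open>2 ^ length w\<close>.\<close>
    moreover have "m * (r + length w + 1) \<le> B * length (encode_pair w r)"
      using b by (intro mult_le_mono) (simp_all add: B_def encode_pair_def)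
    ultimately have "\<rho> ^ L \<le> \<rho> ^ (m * (r + length w + 1))"
      using \<rho> by (intro power_decreasing) auto
    also have "\<dots> = \<rho> ^ m * (\<rho> ^ m) ^ (r + length w)"
      unfolding power_mult[symmetric] power_add[symmetric] by (simp add: algebra_simps)
    also have "\<dots> \<le> (1 - \<rho>) / (2 * C) * (1 / 2) ^ (r + length w)"
      using m \<rho> C(1) by (intro mult_mono power_mono) auto
    finally have \<rho>L: "\<rho> ^ L \<le> (1 - \<rho>) / (2 * C) * (1 / 2) ^ (r + length w)" .
    have "d w - (\<Sum>n\<le>L. t w n) \<le> 2 * C * 2 ^ length w * \<rho> ^ L / (1 - \<rho>)"
      unfolding d_def by (rule tail(3))
    also have "\<dots> \<le> 2 * C * 2 ^ length w * ((1 - \<rho>) / (2 * C) * (1 / 2) ^ (r + length w)) / (1 - \<rho>)"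
      using \<rho>L C(1) \<rho> by (intro divide_right_mono mult_left_mono) auto
    also have "\<dots> = 2 ^ length w * (1 / 2) ^ (r + length w)"
    proof -
      have "x * y * (z / x * v) / z = y * v" if "x \<noteq> 0" "z \<noteq> 0" for x y z v :: real
        using that by (simp add: field_simps)
      then show ?thesis using C(1) \<rho> by simp
    qed
    also have "\<dots> = (1 / 2) ^ r"
      by (simp add: power_add power_one_over)
    also have "\<dots> = 2 powr (- real r)" by (simp add: powr_minus_divide powr_realpow power_one_over)
    finally show ?thesis unfolding fg using tail(2)[of w L] by (simp add: d_def)
  qed
  have "class_martingale \<Delta> d"
    unfolding class_martingale_def using \<open>martingale d\<close> f g approx g_def by blast
  moreover have "2 powr ((1 - s) * real (length w)) \<le> d w" if "w \<in> A" for w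
  proof -
    let ?n = "length w"
    have "q * real ?n \<le> s * real ?n" using q(3) by (intro mult_right_mono) auto
    then have "2 powr ((1 - s) * real ?n) \<le> 2 powr (real ?n - real (c ?n))"
      using c_le[of ?n] by (intro powr_mono) (auto simp: algebra_simps)
    \<comment> \<open>For \<open>w\<close> in \<open>A\<close>, the single term at its own length
      already suffices.\<close>
    also have "\<dots> = t w ?n"
      using that by (simp add: t_def extension_sum_full h_def powr_diff powr_realpow)
    also have "\<dots> \<le> d w"
      unfolding d_def using sum_le_suminf[OF tail(1), of "{?n}" w] t_nonneg by simp
    finally show ?thesis .
  qed
  ultimately show ?thesis by blast
qed

section \<open>From martingales to dimensions\<close>

lemma class_martingale_one:
  assumes "(\<lambda>_. 1) \<in> \<Delta>"
  shows "class_martingale \<Delta> (\<lambda>_. 1)"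
proof -
  have "poly_time_computable (\<lambda>_. 1)"
    using power_cost_poly_time_computable[of 1 "\<lambda>_. False"] by (simp add: cost_def)
  then show ?thesis
    unfolding class_martingale_def martingale_def
    using assms by (auto intro!: bexI[of _ "\<lambda>_. 1"] exI[of _ "\<lambda>_. 1"] exI[of _ 0])
qed

text \<open>The case \<open>s \<le> 1\<close> keeps the rate within one dummy bit per tick; beyond
  it, the values to be reached are at most 1.\<close>

lemma class_martingale_of_entropy:
  assumes A: "\<And>\<beta> B. 0 < B \<Longrightarrow> (\<And>i. \<beta> (i mod B) = \<beta> i) \<Longrightarrow> guess_function \<beta> B A \<in> \<Delta>"
    and "(\<lambda>_. 1) \<in> \<Delta>" and s: "entropy_rate A < ereal s"
  shows "\<exists>d. class_martingale \<Delta> d \<and> (\<forall>w\<in>A. 2 powr ((1 - s) * real (length w)) \<le> d w)"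
proof (cases "s \<le> 1")
  case True
  show ?thesis by (rule class_martingale_of_language[OF A s True])
next
  case False
  then have "2 powr ((1 - s) * real n) \<le> 1" for n
    using powr_mono[of "(1 - s) * real n" 0 2] by (simp add: mult_nonpos_nonneg)
  then show ?thesis using class_martingale_one[OF assms(2)] by auto
qed

text \<open>The martingale is large at every word of \<open>A\<close>, so the same one gives success
  or strong success, according to how often the prefixes lie in \<open>A\<close>.\<close>

lemma dimension_le_entropy:
  assumes \<C>: "\<And>A \<beta> B. A \<in> \<C> \<Longrightarrow> 0 < B \<Longrightarrow> (\<And>i. \<beta> (i mod B) = \<beta> i) \<Longrightarrow> guess_function \<beta> B A \<in> \<Delta>"
    and one: "(\<lambda>_. 1) \<in> \<Delta>"
  shows "dimension \<Delta> X \<le> entropy \<C> X" "strong_dimension \<Delta> X \<le> strong_entropy \<C> X"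
proof -
  have len: "length (prefix_of S n) = n" for S n by (simp add: prefix_of_def)
  \<comment> \<open>The positivity of \<open>s\<close> required by the dimensions comes from the
    nonnegativity of entropy rates.\<close>
  have m: "\<exists>d. 0 < s \<and> class_martingale \<Delta> d \<and> (\<forall>w\<in>A. 2 powr ((1 - s) * real (length w)) \<le> d w)"
    if "A \<in> \<C>" "entropy_rate A < ereal s" for A s
    using class_martingale_of_entropy[OF \<C>[OF that(1)] one that(2)] entropy_rate_nonneg[of A] that(2)
    by (metis ereal_less(2) order.strict_trans1)
  show "dimension \<Delta> X \<le> entropy \<C> X"
    unfolding entropy_def
  proof (rule Inf_greatest, clarify)
    fix A assume A: "A \<in> \<C>" "X \<subseteq> io_set A"
    show "dimension \<Delta> X \<le> entropy_rate A"
    proof (rule ccontr)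
      assume "\<not> dimension \<Delta> X \<le> entropy_rate A"
      then obtain s where s: "entropy_rate A < ereal s" "ereal s < dimension \<Delta> X"
        using ereal_dense2[of "entropy_rate A" "dimension \<Delta> X"] by (metis not_le)
      obtain d where d: "0 < s" "class_martingale \<Delta> d"
        "\<And>w. w \<in> A \<Longrightarrow> 2 powr ((1 - s) * real (length w)) \<le> d w"
        using m[OF A(1) s(1)] by blast
      have "succeeds s d S" if "S \<in> X" for S
      proof -
        have "\<exists>\<^sub>\<infinity>n. prefix_of S n \<in> A" using that A(2) by (auto simp: io_set_def)
        then show ?thesis
          unfolding succeeds_def by (rule INFM_mono) (use d(3) len in metis)
      qed
      then have "dimension \<Delta> X \<le> ereal s"
        unfolding dimension_def using d(1,2) by (intro Inf_lower) auto
      then show False using s(2) by simp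
    qed
  qed
  show "strong_dimension \<Delta> X \<le> strong_entropy \<C> X"
    unfolding strong_entropy_def
  proof (rule Inf_greatest, clarify)
    fix A assume A: "A \<in> \<C>" "X \<subseteq> ae_set A"
    show "strong_dimension \<Delta> X \<le> entropy_rate A"
    proof (rule ccontr)
      assume "\<not> strong_dimension \<Delta> X \<le> entropy_rate A"
      then obtain s where s: "entropy_rate A < ereal s" "ereal s < strong_dimension \<Delta> X"
        using ereal_dense2[of "entropy_rate A" "strong_dimension \<Delta> X"] by (metis not_le)
      obtain d where d: "0 < s" "class_martingale \<Delta> d"
        "\<And>w. w \<in> A \<Longrightarrow> 2 powr ((1 - s) * real (length w)) \<le> d w"
        using m[OF A(1) s(1)] by blast
      have "strongly_succeeds s d S" if "S \<in> X" for S
      proof -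
        have "\<forall>\<^sub>\<infinity>n. prefix_of S n \<in> A" using that A(2) by (auto simp: ae_set_def)
        then show ?thesis
          unfolding strongly_succeeds_def by (rule MOST_mono) (use d(3) len in metis)
      qed
      then have "strong_dimension \<Delta> X \<le> ereal s"
        unfolding strong_dimension_def using d(1,2) by (intro Inf_lower) auto
      then show False using s(2) by simp
    qed
  qed
qed

section \<open>The individual language classes\<close>

lemma guess_function_UP:
  assumes "A \<in> class_UP" "0 < B" "\<And>i. \<beta> (i mod B) = \<beta> i"
  shows "guess_function \<beta> B A \<in> SharpP"
proof -
  obtain M where M: "ntm M" "poly_time M" "\<And>x. card (accepting_paths M x) \<le> 1"
    "A = {x. accepting_paths M x \<noteq> {}}"
    using assms(1) unfolding class_UP_def by blast
  interpret guesser False \<beta> B M using assms M(1) by unfold_locales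
  \<comment> \<open>Finiteness excludes the default value 0 of \<open>card\<close> on infinite
    sets.\<close>
  have A: "card (accepting_paths M x) \<noteq> 0 \<longleftrightarrow> x \<in> A" for x
    using M(4) finite_paths[OF M(1,2)] by (simp add: accepting_paths_eq)
  have "int (card (accepting_paths M x)) = of_bool (x \<in> A)" for x
    using M(3)[of x] A[of x] by (cases "x \<in> A") auto
  then show ?thesis by (intro guess_function_SharpP M(2)) simp_all
qed

lemma guess_function_NP:
  assumes "A \<in> class_NP" "0 < B" "\<And>i. \<beta> (i mod B) = \<beta> i"
  shows "guess_function \<beta> B A \<in> SpanP"
proof -
  obtain M where M: "ntm M" "poly_time M" "A = {x. accepting_paths M x \<noteq> {}}"
    using assms(1) unfolding class_NP_def by blast
  interpret guesser False \<beta> B M using assms M(1) by unfold_locales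
  show ?thesis by (rule guess_function_SpanP) (use M in simp_all)
qed

lemma guess_function_SPP:
  assumes "A \<in> class_SPP" "0 < B" "\<And>i. \<beta> (i mod B) = \<beta> i"
  shows "guess_function \<beta> B A \<in> GapP"
proof -
  obtain M where M: "ntm M" "poly_time M"
    "\<And>x. of_bool (x \<in> A) = int (card (accepting_paths M x)) - int (card (rejecting_paths M x))"
    using assms(1) unfolding class_SPP_def GapP_def by blast
  interpret guesser False \<beta> B M using assms M(1) by unfold_locales
  show ?thesis by (rule guess_function_GapP) (use M in simp_all)
qed

lemma deterministic_moves:
  assumes "deterministic M" "\<tau> \<in> moves M c" "\<sigma> \<in> moves M c"
  shows "\<tau> = \<sigma>"
  using assms by (cases c; cases \<tau>; cases \<sigma>) (auto simp: deterministic_def moves_def)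

text \<open>Neither path can properly extend the other, since each ends in a halted configuration,
  where no move exists.\<close>

lemma deterministic_paths:
  assumes "deterministic M"
  shows "\<tau>s \<in> paths M P c \<Longrightarrow> \<sigma>s \<in> paths M P c \<Longrightarrow> \<tau>s = \<sigma>s"
proof (induction \<tau>s arbitrary: \<sigma>s c)
  case Nil
  then have "moves M c = {}" by (auto simp: paths_def halted_iff_moves)
  then show ?case using Nil(2) by (cases \<sigma>s) (auto simp: paths_def moves_def)
next
  case (Cons \<tau> \<tau>s)
  then have \<tau>: "\<tau> \<in> moves M c" "\<tau>s \<in> paths M P (fire \<tau> c)" by (auto simp: paths_def moves_def)
  then have "\<sigma>s \<in> (\<Union>\<tau>\<in>moves M c. (#) \<tau> ` paths M P (fire \<tau> c))"
    using Cons.prems(2) paths_unfold[of M c P] by blast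
  then obtain \<sigma> \<sigma>s' where \<sigma>: "\<sigma> \<in> moves M c" "\<sigma>s = \<sigma> # \<sigma>s'" "\<sigma>s' \<in> paths M P (fire \<sigma> c)" by blast
  then have "\<sigma> = \<tau>" using deterministic_moves[OF assms \<sigma>(1) \<tau>(1)] by simp
  then show ?case using Cons.IH[OF \<tau>(2)] \<sigma> by simp
qed

lemma class_P_subset_UP: "class_P \<subseteq> class_UP"
proof
  fix A assume "A \<in> class_P"
  then obtain M where M: "ntm M" "deterministic M" "poly_time M" "A = {x. accepting_paths M x \<noteq> {}}"
    unfolding class_P_def by blast
  have "card (accepting_paths M x) \<le> 1" for x
    using deterministic_paths[OF M(2)] unfolding accepting_paths_eq
    by (intro card_le_Suc0_iff_eq[OF finite_paths[OF M(1,3)], THEN iffD2, folded One_nat_def]) blast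
  then show "A \<in> class_UP" using M unfolding class_UP_def by blast
qed

theorem mainTheorem14:
  fixes X :: "(nat \<Rightarrow> bool) set"
  shows "(dimension SharpP X \<le> entropy class_UP X \<and> entropy class_UP X \<le> entropy class_P X) \<and>
    dimension SpanP X \<le> entropy class_NP X \<and>
    dimension GapP X \<le> entropy class_SPP X \<and>
    (strong_dimension SharpP X \<le> strong_entropy class_UP X \<and>
      strong_entropy class_UP X \<le> strong_entropy class_P X) \<and>
    strong_dimension SpanP X \<le> strong_entropy class_NP X \<and>
    strong_dimension GapP X \<le> strong_entropy class_SPP X"
proof -
  have "entropy class_UP X \<le> entropy class_P X" "strong_entropy class_UP X \<le> strong_entropy class_P X"
    unfolding entropy_def strong_entropy_def using class_P_subset_UP
    by (auto intro!: Inf_superset_mono)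
  then show ?thesis
    using dimension_le_entropy[OF guess_function_UP one_in_counting_classes(1)]
      dimension_le_entropy[OF guess_function_NP one_in_counting_classes(2)]
      dimension_le_entropy[OF guess_function_SPP one_in_counting_classes(3)] by simp
qed

end
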